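(* Let $(\lambda_n)_{n\ge1}\in\ell^2\setminus\ell^1$ be a sequence of step sizes (positive numbers). For $x\in\overline{D(A)}$ and $t>0$ define $\phi_{\mathcal S}(t)=\mathcal S_t x$, and for $x\in X$ and $t>0$ define $\phi_{\mathcal T}(t)=\mathcal T_{\nu(t)}x$. Then, for every such $x$, $\phi_{\mathcal S}$ is an almost-orbit of $U_{\mathcal T}$, that is, $$\lim_{t\to\infty}\sup_{h\ge0}\|\phi_{\mathcal S}(t+h)-U_{\mathcal T}(t+h,t)\phi_{\mathcal S}(t)\|=0,$$ and $\phi_{\mathcal T}$ is an almost-orbit of $U_{\mathcal S}$, that is, $$\lim_{t\to\infty}\sup_{h\ge0}\|\phi_{\mathcal T}(t+h)-U_{\mathcal S}(t+h,t)\phi_{\mathcal T}(t)\|=0.$$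
   Context: $X$ is a Banach space whose dual $X^*$ is 2-uniformly convex. Consequently $X$ is reflexive, the duality mapping $j:X\to X^*$, $j(x)=\{x^*\in X^*:\langle x^*,x\rangle=\|x\|^2=\|x^*\|_*^2\}$, is single-valued, and there is a constant $\kappa>0$ such that $\|u+v\|^2\le\|u\|^2+2\langle j(u),v\rangle+\kappa\|v\|^2$ for all $u,v\in X$. $A:X\to 2^X$ is a set-valued operator with domain $D(A)=\{x\in X: Ax\ne\emptyset\}$. It is m-accretive: accretive means $\|x-y+\lambda(u-v)\|\ge\|x-y\|$ for all $\lambda>0$ whenever $u\in Ax$, $v\in Ay$ (equivalently, $\langle j(x-y),u-v\rangle\ge0$ whenever $u\in Ax$, $v\in Ay$), and m-accretive means that, moreover, $I+\lambda A$ is surjective for all $\lambda>0$. Its resolvent $J_\lambda=(I+\lambda A)^{-1}$ is single-valued and everywhere defined. $B:X\to X$ is cocoercive with parameter $\theta>0$: $\langle j(x-y),Bx-By\rangle\ge\theta\|Bx-By\|^2$ for all $x,y\in X$. For $\lambda>0$, $E_\lambda=I-\lambda B$ and $T_\lambda=J_\lambda\circ E_\lambda:X\to X$. Semigroup: for $x\in\overline{D(A)}$ and $t\ge0$, $\mathcal S_tx=u(t)$, where $u:[0,\infty)\to X$ is the unique solution of $-\dot u(t)\in(A+B)u(t)$, $u(0)=x$, understood in the integral sense: $u$ is continuous, $u(0)=x$, and $\|u(t)-z\|^2-\|u(s)-z\|^2\le2\int_s^t\langle j(z-u(\tau)),y\rangle d\tau$ for all $t>s\ge0$, $z\in D(A)$,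 $y\in(A+B)z$. (It is also the limit $u(t)=\lim_{m\to\infty}[T_{t/m}]^m x$.) For $0\le s\le t$, $U_{\mathcal S}(t,s)=\mathcal S_{t-s}$, acting on $\overline{D(A)}$. Discrete system: $\sigma_0=0$, $\sigma_n=\sum_{i=1}^n\lambda_i$; $\nu(t)=\max\{n\in\mathbb N:\sigma_n\le t\}$ for $t\ge 0$; $\mathcal T_nx=T_{\lambda_n}\circ\cdots\circ T_{\lambda_1}x$ ($\mathcal T_0x=x$); and for $0\le s\le t$, $U_{\mathcal T}(t,s)=T_{\lambda_{\nu(t)}}\circ\cdots\circ T_{\lambda_{\nu(s)+1}}$ (identity if $\nu(t)=\nu(s)$). Since $\mathcal T_nx\in D(A)$ for $n\ge1$, $U_{\mathcal S}(t+h,t)\phi_{\mathcal T}(t)$ is defined as soon as $\nu(t)\ge1$, i.e. for all large $t$. *)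

theory Defs
  imports "HOL-Analysis.Analysis"
begin

text \<open>The modulus of convexity takes values in the extended reals so that the infimum over the
  empty set (which occurs when the space is trivial) is infinite.\<close>

definition modulus_of_convexity :: "'b::real_normed_vector itself \<Rightarrow> real \<Rightarrow> ereal" where
  "modulus_of_convexity _ \<epsilon> =
     (INF (x, y) \<in> {(x :: 'b, y). norm x = 1 \<and> norm y = 1 \<and> norm (x - y) \<ge> \<epsilon>}.
        ereal (1 - norm ((x + y) /\<^sub>R 2)))"

definition two_uniformly_convex :: "'b::real_normed_vector itself \<Rightarrow> bool" where
  "two_uniformly_convex T \<longleftrightarrow>
     (\<exists>c>0. \<forall>\<epsilon>. 0 < \<epsilon> \<and> \<epsilon> \<le> 2 \<longrightarrow> modulus_of_convexity T \<epsilon> \<ge> ereal (c * \<epsilon>\<^sup>2))"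

definition duality_set :: "'a::real_normed_vector \<Rightarrow> ('a \<Rightarrow>\<^sub>L real) set" where
  "duality_set x = {f. blinfun_apply f x = (norm x)\<^sup>2 \<and> (norm x)\<^sup>2 = (norm f)\<^sup>2}"

text \<open>The definite description is meaningful when the dual is strictly convex, in
  particular when it is 2-uniformly convex.\<close>

definition duality_map :: "'a::real_normed_vector \<Rightarrow> ('a \<Rightarrow>\<^sub>L real)" where
  "duality_map x = (THE f. f \<in> duality_set x)"

definition op_domain :: "('a \<Rightarrow> 'a set) \<Rightarrow> 'a set" where
  "op_domain A = {x. A x \<noteq> {}}"

definition accretive :: "('a::real_normed_vector \<Rightarrow> 'a set) \<Rightarrow> bool" where
  "accretive A \<longleftrightarrow>
     (\<forall>x y. \<forall>u\<in>A x. \<forall>v\<in>A y. \<forall>r>0. norm (x - y + r *\<^sub>R (u - v)) \<ge> norm (x - y))"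

definition m_accretive :: "('a::real_normed_vector \<Rightarrow> 'a set) \<Rightarrow> bool" where
  "m_accretive A \<longleftrightarrow>
     accretive A \<and> (\<forall>r>0. \<forall>x. \<exists>y. \<exists>u\<in>A y. x = y + r *\<^sub>R u)"

definition cocoercive :: "real \<Rightarrow> ('a::real_normed_vector \<Rightarrow> 'a) \<Rightarrow> bool" where
  "cocoercive \<theta> B \<longleftrightarrow>
     (\<forall>x y. blinfun_apply (duality_map (x - y)) (B x - B y) \<ge> \<theta> * (norm (B x - B y))\<^sup>2)"

definition op_sum :: "('a::real_normed_vector \<Rightarrow> 'a set) \<Rightarrow> ('a \<Rightarrow> 'a) \<Rightarrow> 'a \<Rightarrow> 'a set" where
  "op_sum A B x = {u + B x | u. u \<in> A x}"

definition resolvent :: "('a::real_normed_vector \<Rightarrow> 'a set) \<Rightarrow> real \<Rightarrow> 'a \<Rightarrow> 'a" where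
  "resolvent A r x = (THE y. \<exists>u\<in>A y. x = y + r *\<^sub>R u)"

definition fb_step ::
    "('a::real_normed_vector \<Rightarrow> 'a set) \<Rightarrow> ('a \<Rightarrow> 'a) \<Rightarrow> real \<Rightarrow> 'a \<Rightarrow> 'a" where
  "fb_step A B r x = resolvent A r (x - r *\<^sub>R B x)"

definition integral_solution ::
    "('a::real_normed_vector \<Rightarrow> 'a set) \<Rightarrow> 'a \<Rightarrow> (real \<Rightarrow> 'a) \<Rightarrow> bool" where
  "integral_solution C x u \<longleftrightarrow>
     continuous_on {0..} u \<and> u 0 = x \<and>
     (\<forall>s t. 0 \<le> s \<and> s < t \<longrightarrow> (\<forall>z\<in>op_domain C. \<forall>y\<in>C z.
        (norm (u t - z))\<^sup>2 - (norm (u s - z))\<^sup>2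
          \<le> 2 * integral {s..t} (\<lambda>\<tau>. blinfun_apply (duality_map (z - u \<tau>)) y)))"

text \<open>An integral solution is unconstrained at negative times, so it is its value at
  \<open>t\<close>, rather than the function itself, that is described uniquely.\<close>

definition semigroup_of ::
    "('a::real_normed_vector \<Rightarrow> 'a set) \<Rightarrow> real \<Rightarrow> 'a \<Rightarrow> 'a" where
  "semigroup_of C t x = (THE v. \<exists>u. integral_solution C x u \<and> u t = v)"

definition semigroup_evolution ::
    "('a::real_normed_vector \<Rightarrow> 'a set) \<Rightarrow> real \<Rightarrow> real \<Rightarrow> 'a \<Rightarrow> 'a" where
  "semigroup_evolution C t s = semigroup_of C (t - s)"

text \<open>Step sizes are indexed from 1; the value \<open>lam 0\<close> is never used.\<close>

definition step_sum :: "(nat \<Rightarrow> real) \<Rightarrow> nat \<Rightarrow> real" where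
  "step_sum lam n = (\<Sum>i=1..n. lam i)"

definition step_index :: "(nat \<Rightarrow> real) \<Rightarrow> real \<Rightarrow> nat" where
  "step_index lam t = Max {n. step_sum lam n \<le> t}"

text \<open>The composition of the steps with indices \<open>m + 1, \<dots>, n\<close>, where
  index \<open>m + 1\<close> is applied first.\<close>

definition fb_compose ::
    "('a::real_normed_vector \<Rightarrow> 'a set) \<Rightarrow> ('a \<Rightarrow> 'a) \<Rightarrow> (nat \<Rightarrow> real) \<Rightarrow> nat \<Rightarrow> nat \<Rightarrow> 'a \<Rightarrow> 'a" where
  "fb_compose A B lam m n = fold (\<lambda>i. fb_step A B (lam i)) [Suc m..<Suc n]"

definition discrete_evolution ::
    "('a::real_normed_vector \<Rightarrow> 'a set) \<Rightarrow> ('a \<Rightarrow> 'a) \<Rightarrow> (nat \<Rightarrow> real) \<Rightarrow> real \<Rightarrow> real \<Rightarrow> 'a \<Rightarrow> 'a" where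
  "discrete_evolution A B lam t s = fb_compose A B lam (step_index lam s) (step_index lam t)"

text \<open>The supremum is taken in the extended reals, so no boundedness is presupposed.\<close>

definition almost_orbit ::
    "(real \<Rightarrow> real \<Rightarrow> 'a \<Rightarrow> 'a) \<Rightarrow> (real \<Rightarrow> 'a::real_normed_vector) \<Rightarrow> bool" where
  "almost_orbit U \<phi> \<longleftrightarrow>
     ((\<lambda>t. SUP h\<in>{0..}. ereal (norm (\<phi> (t + h) - U (t + h) t (\<phi> t)))) \<longlongrightarrow> 0) at_top"

end

theory Submission
  imports Defs
begin

text \<open>
  Uniform convexity of the dual makes the duality mapping Lipschitz, so it may be evaluated at a
  nearby point with an error proportional to the distance. The forward-backward steps do not
  increase speed: a trajectory started at a point \<open>x\<close> with \<open>\<parallel>w\<parallel> \<le> M\<close> for some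
  \<open>w \<in> (A + B) x\<close> moves by at most \<open>M r\<close> in a step of size \<open>r\<close>, for ever. Comparing one
  such step with an \<open>M\<close>-Lipschitz integral solution over a time interval of length \<open>r\<close>
  therefore costs \<open>O(r\<^sup>2)\<close> in the squared distance, uniformly in time, and the error committed
  after time \<open>t\<close> is governed by the tail of the convergent series of squared step sizes.
  The same comparison with the uniform steps \<open>t / m\<close> shows that integral solutions are unique
  and contractive; they exist as limits of the iterations with repeatedly halved steps.
\<close>

section \<open>Norming functionals\<close>

text \<open>The definite description in \<open>duality_map\<close> denotes only if each duality set
  is a singleton. Nonemptiness needs a norming functional, hence the Hahn-Banach argument;
  uniqueness is the Lipschitz estimate at equal points. A trajectory from a general point of the
  closure of the domain need not be Lipschitz, and without a speed bound the error of a step is not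
  quadratic in its size, so it cannot be summed. The sets \<open>slow M\<close> remove this
  obstacle: their union is the domain, they are invariant under small steps, and nonexpansiveness
  carries the estimates over to nearby points. Small means \<open>K * r \<le> \<theta>\<close>, true
  of all but finitely many of the given steps; an almost-orbit concerns only large times, so the
  early steps may be arbitrary. For existence, halving has the advantage that the coarse grid lies
  in the fine one; its error of order \<open>sqrt r\<close> is summable over repeated halvings, so
  no two unrelated step sizes are ever compared.\<close>

definition sublinear :: "('a::real_vector \<Rightarrow> real) \<Rightarrow> bool" where
  "sublinear p \<longleftrightarrow> (\<forall>x y. p (x + y) \<le> p x + p y) \<and> (\<forall>x. \<forall>c>0. p (c *\<^sub>R x) \<le> c * p x)"

lemma sublinear_add: "sublinear p \<Longrightarrow> p (x + y) \<le> p x + p y"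
  by (simp add: sublinear_def)

text \<open>Requiring only an inequality in \<open>sublinear\<close> makes infima easy to check; the
  inequality for \<open>inverse c\<close> supplies the converse.\<close>

lemma sublinear_scale:
  assumes "sublinear p" "c > 0"
  shows "p (c *\<^sub>R x) = c * p x"
proof (rule antisym)
  show "p (c *\<^sub>R x) \<le> c * p x"
    using assms by (simp add: sublinear_def)
  have "p (inverse c *\<^sub>R (c *\<^sub>R x)) \<le> inverse c * p (c *\<^sub>R x)"
    using assms unfolding sublinear_def by (meson positive_imp_inverse_positive)
  then show "c * p x \<le> p (c *\<^sub>R x)"
    using assms(2) by (simp add: field_simps)
qed

lemma sublinear_zero: "sublinear p \<Longrightarrow> p 0 = 0"
  using sublinear_scale[of p 2 0] by simp

lemma sublinear_lower: "sublinear p \<Longrightarrow> - p (- x) \<le> p x"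
  using sublinear_add[of p x "- x"] sublinear_zero[of p] by simp

text \<open>For sublinear \<open>p\<close> this is the largest sublinear minorant of
  \<open>p\<close> whose value at \<open>- y\<close> is at most \<open>- p y\<close>. It serves
  twice: to prove that minimal functionals are additive, and to prescribe a norming value.\<close>

definition tilt :: "('a::real_vector \<Rightarrow> real) \<Rightarrow> 'a \<Rightarrow> 'a \<Rightarrow> real" where
  "tilt p y x = (INF t\<in>{0..}. p (x + t *\<^sub>R y) - t * p y)"

lemma tilt_le:
  assumes "sublinear p" "t \<ge> 0"
  shows "tilt p y x \<le> p (x + t *\<^sub>R y) - t * p y"
proof -
  \<comment> \<open>A real infimum is informative only for a set that is bounded below.\<close>
  have "- p (- x) \<le> p (x + s *\<^sub>R y) - s * p y" if "s \<ge> 0" for s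
  proof (cases "s = 0")
    case True
    then show ?thesis using sublinear_lower[OF assms(1), of x] by simp
  next
    case False
    then have "s * p y = p (s *\<^sub>R y)"
      using that sublinear_scale[OF assms(1), of s y] by simp
    also have "\<dots> \<le> p (x + s *\<^sub>R y) + p (- x)"
      using sublinear_add[OF assms(1), of "x + s *\<^sub>R y" "- x"] by simp
    finally show ?thesis by simp
  qed
  then have "bdd_below ((\<lambda>t. p (x + t *\<^sub>R y) - t * p y) ` {0..})"
    by (intro bdd_belowI[of _ "- p (- x)"]) auto
  then show ?thesis
    unfolding tilt_def by (rule cINF_lower) (use assms in simp)
qed

lemma le_tilt: "(\<And>t. t \<ge> 0 \<Longrightarrow> m \<le> p (x + t *\<^sub>R y) - t * p y) \<Longrightarrow> m \<le> tilt p y x"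
  unfolding tilt_def by (rule cINF_greatest) auto

lemma sublinear_tilt:
  assumes p: "sublinear p"
  shows "sublinear (tilt p y)"
  unfolding sublinear_def
proof (intro conjI allI impI)
  fix x z
  have "tilt p y (x + z) - (p (z + s *\<^sub>R y) - s * p y) \<le> tilt p y x" if s: "s \<ge> 0" for s
  proof (rule le_tilt)
    fix t :: real assume t: "t \<ge> 0"
    have "tilt p y (x + z) \<le> p (x + z + (t + s) *\<^sub>R y) - (t + s) * p y"
      using p s t by (intro tilt_le) auto
    moreover have "p (x + z + (t + s) *\<^sub>R y) \<le> p (x + t *\<^sub>R y) + p (z + s *\<^sub>R y)"
      using sublinear_add[OF p, of "x + t *\<^sub>R y" "z + s *\<^sub>R y"] by (simp add: algebra_simps)
    ultimately show "tilt p y (x + z) - (p (z + s *\<^sub>R y) - s * p y) \<le> p (x + t *\<^sub>R y) - t * p y"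
      by (simp add: algebra_simps)
  qed
  then have "tilt p y (x + z) - tilt p y x \<le> tilt p y z"
    by (intro le_tilt) (simp add: algebra_simps)
  then show "tilt p y (x + z) \<le> tilt p y x + tilt p y z" by simp
next
  fix x and c :: real assume c: "c > 0"
  have "tilt p y (c *\<^sub>R x) / c \<le> tilt p y x"
  proof (rule le_tilt)
    fix t :: real assume t: "t \<ge> 0"
    have "tilt p y (c *\<^sub>R x) \<le> p (c *\<^sub>R x + (c * t) *\<^sub>R y) - (c * t) * p y"
      using p c t by (intro tilt_le) auto
    also have "\<dots> = c * (p (x + t *\<^sub>R y) - t * p y)"
      using sublinear_scale[OF p c, of "x + t *\<^sub>R y"] by (simp add: algebra_simps)
    finally show "tilt p y (c *\<^sub>R x) / c \<le> p (x + t *\<^sub>R y) - t * p y"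
      using c by (simp add: field_simps)
  qed
  then show "tilt p y (c *\<^sub>R x) \<le> c * tilt p y x"
    using c by (simp add: field_simps)
qed

text \<open>A minimal sublinear functional is invariant under tilting, which makes it linear.\<close>

lemma sublinear_imp_linear_minorant:
  fixes p0 :: "'a::real_vector \<Rightarrow> real"
  assumes p0: "sublinear p0"
  shows "\<exists>f. linear f \<and> (\<forall>x. f x \<le> p0 x)"
proof -
  define S where "S = {p. sublinear p \<and> p \<le> p0}"
  define R where "R = relation_of (\<lambda>p q :: 'a \<Rightarrow> real. q \<le> p) S"
  have "\<exists>m\<in>S. \<forall>a\<in>S. a \<le> m \<longrightarrow> a = m"
  proof (rule predicate_Zorn)
    show "partial_order_on S (relation_of (\<lambda>p q. q \<le> p) S)"
      by (rule partial_order_on_relation_ofI) auto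
  next
    fix \<C> assume C: "\<C> \<in> Chains (relation_of (\<lambda>p q. q \<le> p) S)"
    then have CS: "\<C> \<subseteq> S" and tot: "\<And>p q. p \<in> \<C> \<Longrightarrow> q \<in> \<C> \<Longrightarrow> p \<le> q \<or> q \<le> p"
      by (auto simp: Chains_def relation_of_def)
    show "\<exists>u\<in>S. \<forall>a\<in>\<C>. u \<le> a"
    proof (cases "\<C> = {}")
      case True
      then show ?thesis using p0 by (auto simp: S_def)
    next
      case False
      define u where "u x = (INF p\<in>\<C>. p x)" for x
      have lower: "- p0 (- x) \<le> p x" if "p \<in> \<C>" for p x
      proof -
        have "sublinear p" "p (- x) \<le> p0 (- x)"
          using CS that by (auto simp: S_def le_fun_def)
        then show ?thesis using sublinear_lower[of p x] by linarith
      qed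
      have u_le: "u x \<le> p x" if "p \<in> \<C>" for p x
        unfolding u_def using that lower
        by (intro cINF_lower bdd_belowI[of _ "- p0 (- x)"]) auto
      have le_u: "m \<le> u x" if "\<And>p. p \<in> \<C> \<Longrightarrow> m \<le> p x" for m x
        unfolding u_def using False that by (intro cINF_greatest) auto
      have "sublinear u"
        unfolding sublinear_def
      proof (intro conjI allI impI)
        fix x y
        have "u (x + y) - q y \<le> u x" if q: "q \<in> \<C>" for q
        proof (rule le_u)
          fix p assume p: "p \<in> \<C>"
          \<comment> \<open>In a chain the smaller of \<open>p\<close> and \<open>q\<close> lies
            below both, so subadditivity of a single member is enough.\<close>
          obtain r where r: "r \<in> \<C>" "r \<le> p" "r \<le> q"
            using tot[OF p q] p q by auto
          have "u (x + y) \<le> r (x + y)" using u_le[OF r(1)] .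
          also have "\<dots> \<le> r x + r y"
            using r(1) CS by (intro sublinear_add) (auto simp: S_def)
          also have "\<dots> \<le> p x + q y"
            using r by (intro add_mono) (auto simp: le_fun_def)
          finally show "u (x + y) - q y \<le> p x" by simp
        qed
        then have "u (x + y) - u x \<le> u y"
          by (intro le_u) (simp add: algebra_simps)
        then show "u (x + y) \<le> u x + u y" by simp
      next
        fix x and c :: real assume c: "c > 0"
        have "u (c *\<^sub>R x) / c \<le> u x"
        proof (rule le_u)
          fix p assume p: "p \<in> \<C>"
          then have "p (c *\<^sub>R x) = c * p x"
            using CS c by (intro sublinear_scale) (auto simp: S_def)
          then show "u (c *\<^sub>R x) / c \<le> p x"
            using u_le[OF p, of "c *\<^sub>R x"] c by (simp add: field_simps)
        qed
        then show "u (c *\<^sub>R x) \<le> c * u x" using c by (simp add: field_simps)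
      qed
      moreover have "u \<le> p0"
      proof -
        obtain p where "p \<in> \<C>" using False by blast
        then have "u \<le> p" "p \<le> p0"
          using u_le CS by (auto simp: le_fun_def S_def)
        then show ?thesis by (rule order_trans)
      qed
      ultimately show ?thesis
        using u_le by (intro bexI[of _ u]) (auto simp: S_def le_fun_def)
    qed
  qed
  then obtain p where p: "sublinear p" "p \<le> p0"
    and minimal: "\<And>q. sublinear q \<Longrightarrow> q \<le> p \<Longrightarrow> q = p"
    unfolding S_def by (metis (no_types, lifting) mem_Collect_eq order_trans)
  have tilt_p: "tilt p y = p" for y
    using tilt_le[OF p(1), of 0 y]
    by (intro minimal sublinear_tilt p(1)) (auto simp: le_fun_def)
  \<comment> \<open>With \<open>t = 1\<close>, invariance under tilting reads
    \<open>p x \<le> p (x + y) - p y\<close>, the missing half of additivity.\<close>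
  have add: "p (x + y) = p x + p y" for x y
    using tilt_le[OF p(1), of 1 y x] sublinear_add[OF p(1), of x y] by (simp add: tilt_p)
  have neg: "p (- x) = - p x" for x
    using add[of x "- x"] sublinear_zero[OF p(1)] by simp
  have "p (c *\<^sub>R x) = c * p x" for c x
  proof -
    consider "c > 0" | "c = 0" | "- c > 0" by linarith
    then show ?thesis
    proof cases
      case 3
      then show ?thesis
        using sublinear_scale[OF p(1) 3, of x] neg[of "c *\<^sub>R x"] by simp
    qed (simp_all add: sublinear_scale[OF p(1)] sublinear_zero[OF p(1)])
  qed
  then have "linear p" using add by (intro linearI) auto
  then show ?thesis using p(2) by (auto simp: le_fun_def)
qed

text \<open>A linear minorant of the norm alone need not see \<open>x0\<close>. Tilting the norm
  along \<open>x0\<close> first forces \<open>f (- x0) \<le> - norm x0\<close>, so that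
  \<open>f\<close> norms \<open>x0\<close>; the factor \<open>norm x0\<close> then gives the
  normalization of the duality set.\<close>

lemma duality_set_nonempty:
  fixes x0 :: "'a::real_normed_vector"
  shows "duality_set x0 \<noteq> {}"
proof -
  have nsub: "sublinear (norm :: 'a \<Rightarrow> real)"
    by (auto simp: sublinear_def norm_triangle_ineq)
  obtain f where f: "linear f" "\<And>x. f x \<le> tilt norm x0 x"
    using sublinear_imp_linear_minorant[OF sublinear_tilt[OF nsub]] by blast
  have le_norm: "f x \<le> norm x" for x
    using f(2)[of x] tilt_le[OF nsub, of 0 x0 x] by simp
  have bound: "\<bar>f x\<bar> \<le> norm x" for x
    using le_norm[of x] le_norm[of "- x"] linear_neg[OF f(1), of x] by simp
  have "f (- x0) \<le> - norm x0"
    using f(2)[of "- x0"] tilt_le[OF nsub, of 1 x0 "- x0"] by simp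
  then have fx0: "f x0 = norm x0"
    using linear_neg[OF f(1), of x0] le_norm[of x0] by simp
  have lin: "bounded_linear f"
    using f(1) bound by (intro bounded_linear_intro[where K = 1])
      (auto simp: linear_add linear_scale)
  define F where "F = norm x0 *\<^sub>R Blinfun f"
  have F: "blinfun_apply F x = norm x0 * f x" for x
    by (simp add: F_def bounded_linear_Blinfun_apply[OF lin] blinfun.scaleR_left)
  have "norm F \<le> norm x0"
  proof (rule norm_blinfun_bound)
    show "norm (blinfun_apply F x) \<le> norm x0 * norm x" for x
      using bound[of x] by (auto simp: F abs_mult intro: mult_left_mono)
  qed simp
  moreover have "norm x0 \<le> norm F"
  proof (cases "x0 = 0")
    case False
    have "norm x0 * norm x0 \<le> norm F * norm x0"
      using norm_blinfun[of F x0] by (simp add: F fx0)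
    then show ?thesis using False by simp
  qed simp
  ultimately have "F \<in> duality_set x0"
    by (simp add: duality_set_def F fx0 power2_eq_square)
  then show ?thesis by blast
qed

section \<open>Lipschitz continuity of the duality mapping\<close>

lemma duality_set_scaleR:
  assumes "f \<in> duality_set x"
  shows "c *\<^sub>R f \<in> duality_set (c *\<^sub>R x)"
proof -
  have "blinfun_apply f x = (norm x)\<^sup>2" "norm f = norm x"
    using assms by (auto simp: duality_set_def)
  then show ?thesis
    by (simp add: duality_set_def blinfun.scaleR_left blinfun.scaleR_right power_mult_distrib)
      (simp add: power2_eq_square)
qed

lemma duality_set_norm: "f \<in> duality_set x \<Longrightarrow> norm f = norm x"
  by (simp add: duality_set_def)

lemma duality_set_apply: "f \<in> duality_set x \<Longrightarrow> blinfun_apply f x = (norm x)\<^sup>2"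
  by (simp add: duality_set_def)

lemma blinfun_le: "blinfun_apply f (x :: 'a::real_normed_vector) \<le> norm f * norm x"
  using norm_blinfun[of f x] by simp

lemma two_uniformly_convexE:
  assumes "two_uniformly_convex TYPE('b::real_normed_vector)"
  obtains c where "c > 0"
    "\<And>f g :: 'b. norm f = 1 \<Longrightarrow> norm g = 1 \<Longrightarrow> norm (f + g) \<le> 2 * (1 - c * (norm (f - g))\<^sup>2)"
proof -
  obtain c where c: "c > 0"
    "\<And>\<epsilon>. 0 < \<epsilon> \<Longrightarrow> \<epsilon> \<le> 2 \<Longrightarrow> ereal (c * \<epsilon>\<^sup>2) \<le> modulus_of_convexity TYPE('b) \<epsilon>"
    using assms by (auto simp: two_uniformly_convex_def)
  show thesis
  proof (rule that[OF c(1)])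
    fix f g :: 'b assume fg: "norm f = 1" "norm g = 1"
    show "norm (f + g) \<le> 2 * (1 - c * (norm (f - g))\<^sup>2)"
    proof (cases "f = g")
      case True
      then show ?thesis using fg norm_triangle_ineq[of f g] by simp
    next
      case False
      have "ereal (c * (norm (f - g))\<^sup>2) \<le> modulus_of_convexity TYPE('b) (norm (f - g))"
        using False fg norm_triangle_ineq4[of f g] by (intro c(2)) auto
      also have "\<dots> \<le> ereal (1 - norm ((f + g) /\<^sub>R 2))"
        unfolding modulus_of_convexity_def
        by (rule INF_lower2[of "(f, g)"]) (use fg in auto)
      finally show ?thesis by simp
    qed
  qed
qed

text \<open>The factor \<open>norm y\<close> turns the second unit vector into \<open>y\<close> and
  the first into a multiple of \<open>x\<close> that is off by
  \<open>\<bar>norm y - norm x\<bar>\<close>. This extends estimates from the unit sphere by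
  homogeneity.\<close>

lemma norm_normalized_diff:
  fixes x y :: "'a::real_normed_vector"
  assumes "x \<noteq> 0" "y \<noteq> 0"
  shows "norm y * norm (x /\<^sub>R norm x - y /\<^sub>R norm y) \<le> 2 * norm (x - y)"
proof -
  have "norm y * norm (x /\<^sub>R norm x - y /\<^sub>R norm y) = norm (norm y *\<^sub>R (x /\<^sub>R norm x - y /\<^sub>R norm y))"
    by simp
  also have "norm y *\<^sub>R (x /\<^sub>R norm x - y /\<^sub>R norm y) = (x - y) + ((norm y - norm x) / norm x) *\<^sub>R x"
    using assms by (simp add: algebra_simps diff_divide_distrib divide_inverse)
  also have "norm \<dots> \<le> norm (x - y) + \<bar>norm y - norm x\<bar>"
    using norm_triangle_ineq[of "x - y" "((norm y - norm x) / norm x) *\<^sub>R x"] assms by simp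
  also have "\<bar>norm y - norm x\<bar> \<le> norm (x - y)"
    by (metis norm_minus_commute norm_triangle_ineq3)
  finally show ?thesis by simp
qed

text \<open>On the unit sphere, \<open>x\<close> and \<open>y\<close> norm \<open>f\<close> and
  \<open>g\<close>, so convexity of the dual ball bounds \<open>f + g\<close> at both points; adding
  the two bounds gives \<open>4 * c * e\<^sup>2 \<le> (f - g) (x - y) \<le> e * norm (x - y)\<close>
  for \<open>e = norm (f - g)\<close>. Speaking of arbitrary members of the duality sets lets the
  case \<open>x = y\<close> yield single-valuedness.\<close>

lemma duality_set_lipschitz:
  assumes "two_uniformly_convex TYPE('a::real_normed_vector \<Rightarrow>\<^sub>L real)"
  obtains K where "K > 0"
    "\<And>(x::'a) y f g. f \<in> duality_set x \<Longrightarrow> g \<in> duality_set y \<Longrightarrow> norm (f - g) \<le> K * norm (x - y)"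
proof -
  obtain c where c: "c > 0" and uc:
    "\<And>f g :: 'a \<Rightarrow>\<^sub>L real. norm f = 1 \<Longrightarrow> norm g = 1 \<Longrightarrow>
        norm (f + g) \<le> 2 * (1 - c * (norm (f - g))\<^sup>2)"
    using two_uniformly_convexE[OF assms] by metis
  define k where "k = 1 / (4 * c)"
  have k: "k > 0" using c by (simp add: k_def)
  have sphere: "norm (f - g) \<le> k * norm (x - y)"
    if "f \<in> duality_set x" "g \<in> duality_set y" "norm x = 1" "norm y = 1" for x y :: 'a and f g
  proof -
    define e where "e = norm (f - g)"
    have n: "norm f = 1" "norm g = 1" "blinfun_apply f x = 1" "blinfun_apply g y = 1"
      using that duality_set_norm duality_set_apply by fastforce+
    have "blinfun_apply (f + g) x \<le> 2 * (1 - c * e\<^sup>2)"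
         "blinfun_apply (f + g) y \<le> 2 * (1 - c * e\<^sup>2)"
      using blinfun_le[of "f + g" x] blinfun_le[of "f + g" y] uc[OF n(1,2)] that
      by (simp_all add: e_def)
    then have "4 * c * e\<^sup>2 \<le> blinfun_apply (f - g) (x - y)"
      by (simp add: blinfun.add_left blinfun.diff_left blinfun.diff_right n)
    also have "\<dots> \<le> e * norm (x - y)"
      unfolding e_def by (rule blinfun_le)
    finally have "e * (4 * c * e) \<le> e * norm (x - y)"
      by (simp add: power2_eq_square algebra_simps)
    then have "4 * c * e \<le> norm (x - y)"
      by (cases "e = 0") (auto simp: e_def)
    then show ?thesis using c by (simp add: k_def e_def field_simps)
  qed
  have lip: "norm (f - g) \<le> (1 + 2 * k) * norm (x - y)"
    if f: "f \<in> duality_set x" and g: "g \<in> duality_set y" for x y :: 'a and f g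
  proof (cases "x = 0 \<or> y = 0")
    case True
    then have "norm (f - g) \<le> norm (x - y)"
      using duality_set_norm[OF f] duality_set_norm[OF g] by auto
    also have "\<dots> \<le> (1 + 2 * k) * norm (x - y)"
      using k by (simp add: algebra_simps)
    finally show ?thesis .
  next
    case False
    then have x: "x \<noteq> 0" and y: "y \<noteq> 0" by auto
    \<comment> \<open>The first summand is the radial difference; the second is the sphere estimate
      scaled by \<open>norm y\<close>.\<close>
    have "f - g = ((norm x - norm y) / norm x) *\<^sub>R f + norm y *\<^sub>R (f /\<^sub>R norm x - g /\<^sub>R norm y)"
      using x y by (simp add: algebra_simps diff_divide_distrib divide_inverse)
    then have "norm (f - g) \<le> norm (((norm x - norm y) / norm x) *\<^sub>R f)
        + norm (norm y *\<^sub>R (f /\<^sub>R norm x - g /\<^sub>R norm y))"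
      using norm_triangle_ineq by metis
    also have "norm (((norm x - norm y) / norm x) *\<^sub>R f) = \<bar>norm x - norm y\<bar>"
      using x by (simp add: duality_set_norm[OF f])
    also have "\<dots> \<le> norm (x - y)"
      by (rule norm_triangle_ineq3)
    also have "norm (norm y *\<^sub>R (f /\<^sub>R norm x - g /\<^sub>R norm y))
        \<le> norm y * (k * norm (x /\<^sub>R norm x - y /\<^sub>R norm y))"
      using sphere[OF duality_set_scaleR[OF f] duality_set_scaleR[OF g],
          of "inverse (norm x)" "inverse (norm y)"] x y
      by (simp add: mult_left_mono)
    also have "\<dots> \<le> k * (2 * norm (x - y))"
      using mult_left_mono[OF norm_normalized_diff[OF x y], of k] k by (simp add: algebra_simps)
    finally show ?thesis by (simp add: algebra_simps)
  qed
  show thesis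
    using k lip by (intro that[of "1 + 2 * k"]) auto
qed

section \<open>Forward-backward steps\<close>

text \<open>Uniform convexity enters from here on only through the Lipschitz constant
  \<open>K\<close>.\<close>

locale forward_backward =
  fixes A :: "'a::banach \<Rightarrow> 'a set" and B :: "'a \<Rightarrow> 'a" and \<theta> K :: real
  assumes K_pos: "K > 0"
    and duality_set_lip: "\<And>(x::'a) y f g. f \<in> duality_set x \<Longrightarrow> g \<in> duality_set y \<Longrightarrow>
          norm (f - g) \<le> K * norm (x - y)"
    and m_accretive: "m_accretive A"
    and \<theta>_pos: "\<theta> > 0"
    and cocoercive: "cocoercive \<theta> B"
begin

section \<open>The single-valued duality mapping and the squared norm\<close>

abbreviation j :: "'a \<Rightarrow> 'a \<Rightarrow> real" where
  "j x \<equiv> blinfun_apply (duality_map x)"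

lemma duality_set_unique:
  assumes "f \<in> duality_set (x::'a)" "g \<in> duality_set x"
  shows "f = g"
  using duality_set_lip[OF assms] by simp

lemma duality_map_eq:
  assumes "f \<in> duality_set (x::'a)"
  shows "duality_map x = f"
  unfolding duality_map_def using assms duality_set_unique by (intro the_equality) auto

lemma duality_map_in: "duality_map (x::'a) \<in> duality_set x"
  using duality_set_nonempty[of x] duality_map_eq by auto

lemma norm_duality_map: "norm (duality_map (x::'a)) = norm x"
  using duality_set_norm[OF duality_map_in] .

lemma j_self: "j x x = (norm x)\<^sup>2"
  using duality_set_apply[OF duality_map_in] .

lemma j_minus: "j (- x) v = - j x v"
proof -
  have "duality_map (- x) = - duality_map x"
    using duality_set_scaleR[OF duality_map_in, of "-1" x] by (intro duality_map_eq) simp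
  then show ?thesis by (simp add: blinfun.minus_left)
qed

lemma j_abs_le: "\<bar>j x v\<bar> \<le> norm x * norm v"
  using norm_blinfun[of "duality_map x" v] by (simp add: norm_duality_map)

lemma j_lip: "\<bar>j x v - j y v\<bar> \<le> K * norm (x - y) * norm v"
proof -
  have "\<bar>j x v - j y v\<bar> \<le> norm (duality_map x - duality_map y) * norm v"
    using norm_blinfun[of "duality_map x - duality_map y" v] by (simp add: blinfun.diff_left)
  also have "\<dots> \<le> (K * norm (x - y)) * norm v"
    by (intro mult_right_mono duality_set_lip duality_map_in) auto
  finally show ?thesis .
qed

lemma continuous_on_j:
  assumes "continuous_on S f"
  shows "continuous_on S (\<lambda>t. j (f t) v)"
proof -
  have "(K * norm v)-lipschitz_on UNIV (\<lambda>x. j x v)"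
    using j_lip K_pos by (intro lipschitz_onI) (auto simp: dist_norm algebra_simps)
  then have "continuous_on UNIV (\<lambda>x. j x v)"
    by (rule lipschitz_on_continuous_on)
  then show ?thesis
    using assms by (rule continuous_on_compose2) auto
qed

text \<open>The functional \<open>2 * j u\<close> is a subgradient of the squared norm at
  \<open>u\<close>; this is the arithmetic-geometric mean inequality after
  \<open>j u (u + v) \<le> norm u * norm (u + v)\<close>.\<close>

lemma norm_sq_lower: "(norm u)\<^sup>2 + 2 * j u v \<le> (norm (u + v))\<^sup>2"
proof -
  have "(norm u)\<^sup>2 + j u v = j u (u + v)"
    by (simp add: blinfun.add_right j_self)
  also have "\<dots> \<le> norm u * norm (u + v)"
    using j_abs_le[of u "u + v"] by simp
  also have "2 * \<dots> \<le> (norm u)\<^sup>2 + (norm (u + v))\<^sup>2"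
    using sum_squares_bound[of "norm u" "norm (u + v)"] by simp
  finally show ?thesis by simp
qed

text \<open>The smoothness inequality of the space with \<kappa> = \<open>2 * K\<close>: the
  subgradient inequality at \<open>u + v\<close>, followed by moving the duality mapping back to
  \<open>u\<close> at the cost \<open>K * (norm v)\<^sup>2\<close>.\<close>

lemma norm_sq_upper: "(norm (u + v))\<^sup>2 \<le> (norm u)\<^sup>2 + 2 * j u v + 2 * K * (norm v)\<^sup>2"
proof -
  have "(norm (u + v))\<^sup>2 \<le> (norm u)\<^sup>2 + 2 * j (u + v) v"
    using norm_sq_lower[of "u + v" "- v"] by (simp add: blinfun.minus_right)
  moreover have "j (u + v) v \<le> j u v + K * (norm v)\<^sup>2"
    using j_lip[of "u + v" v u] by (simp add: power2_eq_square algebra_simps)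
  ultimately show ?thesis by simp
qed

section \<open>Accretivity, cocoercivity and nonexpansive steps\<close>

lemma accretive_norm:
  assumes "a \<in> A x" "b \<in> A y" "r > 0"
  shows "norm (x - y) \<le> norm (x - y + r *\<^sub>R (a - b))"
  using m_accretive assms by (auto simp: m_accretive_def accretive_def)

text \<open>A negative pairing would make the squared norm decrease to first order in
  \<open>r\<close>, while \<open>norm_sq_upper\<close> limits the correction to second order; for
  small \<open>r\<close> this contradicts accretivity in norm form.\<close>

lemma j_accretive:
  assumes "a \<in> A x" "b \<in> A y"
  shows "0 \<le> j (x - y) (a - b)"
proof (rule ccontr)
  define \<delta> where "\<delta> = - j (x - y) (a - b)"
  assume "\<not> 0 \<le> j (x - y) (a - b)"
  then have \<delta>: "\<delta> > 0" by (simp add: \<delta>_def)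
  \<comment> \<open>The summand 1 keeps \<open>N\<close> positive when \<open>a = b\<close> and
    leaves exactly the strict gain \<open>- 2 * r\<^sup>2\<close> at the end.\<close>
  define N where "N = K * (norm (a - b))\<^sup>2 + 1"
  have N: "N > 0" using K_pos by (simp add: N_def add_nonneg_pos)
  define r where "r = \<delta> / N"
  have r: "r > 0" using \<delta> N by (simp add: r_def)
  have "(norm (x - y))\<^sup>2 \<le> (norm (x - y + r *\<^sub>R (a - b)))\<^sup>2"
    using accretive_norm[OF assms r] by (rule power_mono) simp
  also have "\<dots> \<le> (norm (x - y))\<^sup>2 + 2 * (r * j (x - y) (a - b)) + 2 * K * (r\<^sup>2 * (norm (a - b))\<^sup>2)"
    using norm_sq_upper[of "x - y" "r *\<^sub>R (a - b)"]
    by (simp add: blinfun.scaleR_right power_mult_distrib)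
  also have "\<dots> = (norm (x - y))\<^sup>2 - 2 * r * \<delta> + 2 * r * (r * (N - 1))"
    unfolding \<delta>_def N_def by (simp add: power2_eq_square)
  also have "r * (N - 1) = \<delta> - r"
    using N by (simp add: r_def field_simps)
  also have "(norm (x - y))\<^sup>2 - 2 * r * \<delta> + 2 * r * (\<delta> - r) = (norm (x - y))\<^sup>2 - 2 * r\<^sup>2"
    by (simp add: power2_eq_square algebra_simps)
  finally show False using r by simp
qed

lemma j_cocoercive: "\<theta> * (norm (B x - B y))\<^sup>2 \<le> j (x - y) (B x - B y)"
  using cocoercive by (simp add: cocoercive_def)

lemma B_lip: "norm (B x - B y) \<le> norm (x - y) / \<theta>"
proof -
  have "norm (B x - B y) * (\<theta> * norm (B x - B y)) \<le> norm (B x - B y) * norm (x - y)"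
    using j_cocoercive[of x y] j_abs_le[of "x - y" "B x - B y"]
    by (simp add: power2_eq_square algebra_simps)
  then have "\<theta> * norm (B x - B y) \<le> norm (x - y)"
    by (cases "norm (B x - B y) = 0") (auto simp: mult_le_cancel_left)
  then show ?thesis using \<theta>_pos by (simp add: field_simps)
qed

text \<open>Cocoercivity gains \<open>2 * r * \<theta> * (norm b)\<^sup>2\<close>, smoothness costs
  \<open>2 * K * r\<^sup>2 * (norm b)\<^sup>2\<close>; the condition
  \<open>K * r \<le> \<theta>\<close> on all small steps comes from balancing the two.\<close>

lemma forward_nonexpansive:
  assumes "r \<ge> 0" "K * r \<le> \<theta>"
  shows "norm ((x - r *\<^sub>R B x) - (y - r *\<^sub>R B y)) \<le> norm (x - y)"
proof -
  define b where "b = B x - B y"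
  have "(norm ((x - y) + - (r *\<^sub>R b)))\<^sup>2 \<le> (norm (x - y))\<^sup>2 - 2 * r * j (x - y) b + 2 * K * r * r * (norm b)\<^sup>2"
    using norm_sq_upper[of "x - y" "- (r *\<^sub>R b)"]
    by (simp add: blinfun.minus_right blinfun.scaleR_right power_mult_distrib power2_eq_square algebra_simps)
  also have "\<dots> \<le> (norm (x - y))\<^sup>2"
  proof -
    have "K * r * (norm b)\<^sup>2 \<le> \<theta> * (norm b)\<^sup>2"
      using assms by (intro mult_right_mono) auto
    also have "\<dots> \<le> j (x - y) b" unfolding b_def by (rule j_cocoercive)
    finally have "2 * r * (K * r * (norm b)\<^sup>2) \<le> 2 * r * j (x - y) b"
      using assms by (intro mult_left_mono) auto
    then show ?thesis by (simp add: algebra_simps)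
  qed
  finally have "norm ((x - y) + - (r *\<^sub>R b)) \<le> norm (x - y)"
    using power2_le_imp_le norm_ge_zero by blast
  then show ?thesis by (simp add: b_def algebra_simps)
qed

lemma resolvent_nonexpansive:
  assumes "r > 0" "a \<in> A x" "b \<in> A y"
  shows "norm (x - y) \<le> norm ((x + r *\<^sub>R a) - (y + r *\<^sub>R b))"
  using accretive_norm[OF assms(2,3,1)] by (simp add: algebra_simps)

lemma resolvent_in:
  assumes "r > 0"
  shows "\<exists>a\<in>A (resolvent A r x). x = resolvent A r x + r *\<^sub>R a"
  unfolding resolvent_def
proof (rule theI')
  show "\<exists>!y. \<exists>a\<in>A y. x = y + r *\<^sub>R a"
  proof (rule ex_ex1I)
    show "\<exists>y. \<exists>a\<in>A y. x = y + r *\<^sub>R a"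
      using m_accretive assms by (simp add: m_accretive_def)
  next
    fix y z
    assume "\<exists>a\<in>A y. x = y + r *\<^sub>R a" "\<exists>a\<in>A z. x = z + r *\<^sub>R a"
    then obtain a b where "a \<in> A y" "x = y + r *\<^sub>R a" "b \<in> A z" "x = z + r *\<^sub>R b" by blast
    then show "y = z"
      using resolvent_nonexpansive[OF assms, of a y b z] by simp
  qed
qed

section \<open>Invariant speed bounds and the one-step comparison\<close>

abbreviation T :: "real \<Rightarrow> 'a \<Rightarrow> 'a" where
  "T \<equiv> fb_step A B"

abbreviation C :: "'a \<Rightarrow> 'a set" where
  "C \<equiv> op_sum A B"

lemma fb_stepE:
  assumes "r > 0"
  obtains a where "a \<in> A (T r p)" "p - r *\<^sub>R B p = T r p + r *\<^sub>R a"
  using resolvent_in[OF assms] unfolding fb_step_def by blast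

lemma fb_step_nonexpansive:
  assumes "r > 0" "K * r \<le> \<theta>"
  shows "norm (T r p - T r q) \<le> norm (p - q)"
proof -
  obtain a b where "a \<in> A (T r p)" "p - r *\<^sub>R B p = T r p + r *\<^sub>R a"
      "b \<in> A (T r q)" "q - r *\<^sub>R B q = T r q + r *\<^sub>R b"
    using fb_stepE[OF assms(1)] by metis
  then have "norm (T r p - T r q) \<le> norm ((p - r *\<^sub>R B p) - (q - r *\<^sub>R B q))"
    using resolvent_nonexpansive[OF assms(1)] by metis
  also have "\<dots> \<le> norm (p - q)"
    using assms by (intro forward_nonexpansive) auto
  finally show ?thesis .
qed

lemma j_accretive_sum:
  assumes "w \<in> C x" "w' \<in> C y"
  shows "0 \<le> j (x - y) (w - w')"
proof -
  obtain a b where ab: "a \<in> A x" "w = a + B x" "b \<in> A y" "w' = b + B y"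
    using assms by (auto simp: op_sum_def)
  have "0 \<le> \<theta> * (norm (B x - B y))\<^sup>2" using \<theta>_pos by simp
  also have "\<dots> \<le> j (x - y) (B x - B y)" by (rule j_cocoercive)
  finally have "0 \<le> j (x - y) (a - b) + j (x - y) (B x - B y)"
    using j_accretive[OF ab(1,3)] by simp
  then show ?thesis by (simp add: ab blinfun.diff_right blinfun.add_right)
qed

text \<open>Essentially the sublevel sets of the distance from 0 to \<open>C x\<close>. They exhaust
  the domain of \<open>A\<close>, and \<open>M\<close> bounds the speed of the trajectories that
  start in \<open>slow M\<close>.\<close>

definition slow :: "real \<Rightarrow> 'a set" where
  "slow M = {x. \<exists>w\<in>C x. norm w \<le> M}"

lemma slow_nonneg: "x \<in> slow M \<Longrightarrow> M \<ge> 0"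
  by (auto simp: slow_def intro: order_trans[OF norm_ge_zero])

lemma slow_subset_domain: "slow M \<subseteq> op_domain A"
  by (auto simp: slow_def op_sum_def op_domain_def)

lemma domain_slow: "x \<in> op_domain A \<Longrightarrow> \<exists>M. x \<in> slow M"
  by (auto simp: slow_def op_sum_def op_domain_def)

text \<open>
  Since \<open>w = a + B (T r p)\<close> with \<open>r w = (p - r B p) - (T r p - r B (T r p))\<close>, nonexpansiveness of
  the forward step bounds \<open>w\<close> by \<open>\<parallel>p - T r p\<parallel> / r\<close>; this is why \<open>M\<close> does not deteriorate
  along the iteration.
\<close>

lemma fb_step_slowE:
  assumes p: "p \<in> slow M" and r: "r > 0" "K * r \<le> \<theta>"
  obtains w where "w \<in> C (T r p)" "norm w \<le> M" "norm (p - T r p) \<le> r * M"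
    "norm (p - T r p - r *\<^sub>R w) \<le> r * (r * M / \<theta>)"
proof -
  obtain a where a: "a \<in> A (T r p)" "p - r *\<^sub>R B p = T r p + r *\<^sub>R a"
    using fb_stepE[OF r(1)] by blast
  obtain b where b: "b \<in> A p" "norm (b + B p) \<le> M"
    using p by (auto simp: slow_def op_sum_def)
  have eq: "p - T r p = r *\<^sub>R (a + B p)"
    using a(2) by (simp add: algebra_simps)
  have "norm (p - T r p) \<le> norm (p - T r p + r *\<^sub>R (b - a))"
    by (rule accretive_norm[OF b(1) a(1) r(1)])
  also have "p - T r p + r *\<^sub>R (b - a) = r *\<^sub>R (b + B p)"
    by (simp add: eq algebra_simps)
  also have "norm \<dots> \<le> r * M"
    using b(2) r by simp
  finally have dist: "norm (p - T r p) \<le> r * M" .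
  define w where "w = a + B (T r p)"
  have "r *\<^sub>R w = (p - r *\<^sub>R B p) - (T r p - r *\<^sub>R B (T r p))"
    using eq by (simp add: w_def algebra_simps)
  then have "norm (r *\<^sub>R w) \<le> norm (p - T r p)"
    using forward_nonexpansive[of r p "T r p"] r by simp
  with dist have "norm (r *\<^sub>R w) \<le> r * M" by linarith
  then have "r * norm w \<le> r * M" using r(1) by (simp only: norm_scaleR abs_of_pos)
  then have "norm w \<le> M" using r(1) by (rule mult_left_le_imp_le)
  moreover have "w \<in> C (T r p)" using a by (auto simp: w_def op_sum_def)
  moreover have "norm (p - T r p - r *\<^sub>R w) \<le> r * (r * M / \<theta>)"
  proof -
    have "p - T r p - r *\<^sub>R w = r *\<^sub>R (B p - B (T r p))"
      by (simp add: eq w_def algebra_simps)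
    then have "norm (p - T r p - r *\<^sub>R w) = r * norm (B p - B (T r p))" using r by simp
    also have "\<dots> \<le> r * (norm (p - T r p) / \<theta>)"
      using r B_lip by (intro mult_left_mono) auto
    also have "\<dots> \<le> r * (r * M / \<theta>)"
      using dist r \<theta>_pos by (intro mult_left_mono divide_right_mono) auto
    finally show ?thesis .
  qed
  ultimately show thesis using dist that by blast
qed

lemma fb_step_slow:
  assumes "p \<in> slow M" "r > 0" "K * r \<le> \<theta>"
  shows "T r p \<in> slow M" "norm (p - T r p) \<le> r * M"
proof -
  obtain w where "w \<in> C (T r p)" "norm w \<le> M" "norm (p - T r p) \<le> r * M"
    using fb_step_slowE[OF assms] by metis
  then show "T r p \<in> slow M" "norm (p - T r p) \<le> r * M" by (auto simp: slow_def)
qed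

text \<open>Both summands come from evaluating \<open>B\<close> at the old point instead of the new
  one: \<open>(M / \<theta>)\<^sup>2\<close> is left by Young's inequality, and
  \<open>2 * M\<^sup>2 / K\<close> arises from \<open>2 * M\<^sup>2 * (r / \<theta>)\<close> because
  \<open>r / \<theta> \<le> 1 / K\<close>.\<close>

definition step_const :: "real \<Rightarrow> real" where
  "step_const M = (M / \<theta>)\<^sup>2 + 2 * M\<^sup>2 / K"

lemma step_const_nonneg: "step_const M \<ge> 0"
  using K_pos by (simp add: step_const_def)

text \<open>
  Tests the integral inequality at \<open>z = T r p\<close> and adds the subgradient inequality for the squared
  norm at \<open>v s - T r p\<close>; the terms \<open>r j (T r p - v s) w\<close> cancel.
\<close>

lemma integral_solution_step:
  assumes v: "integral_solution C x v" and s: "s \<ge> 0"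
    and p: "p \<in> slow M" and r: "r > 0" "K * r \<le> \<theta>"
    and \<omega>: "\<And>\<tau>. s \<le> \<tau> \<Longrightarrow> \<tau> \<le> s + r \<Longrightarrow> norm (v \<tau> - v s) \<le> \<omega>"
  shows "(norm (v (s + r) - T r p))\<^sup>2
    \<le> (1 + r\<^sup>2) * (norm (v s - p))\<^sup>2 + 2 * r * (K * \<omega> * M) + r\<^sup>2 * step_const M"
proof -
  define q where "q = T r p"
  obtain w where w: "w \<in> C q" "norm w \<le> M" "norm (p - q) \<le> r * M"
    "norm (p - q - r *\<^sub>R w) \<le> r * (r * M / \<theta>)"
    using fb_step_slowE[OF p r] unfolding q_def by metis
  have M: "M \<ge> 0" using p by (rule slow_nonneg)
  have \<omega>0: "\<omega> \<ge> 0" using \<omega>[of s] r by simp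
  have cont: "continuous_on {0..} v" using v by (simp add: integral_solution_def)
  have "q \<in> op_domain C" using w(1) by (auto simp: op_domain_def)
  then have "(norm (v (s + r) - q))\<^sup>2 - (norm (v s - q))\<^sup>2
      \<le> 2 * integral {s..s + r} (\<lambda>\<tau>. j (q - v \<tau>) w)"
    using v w(1) s r by (simp add: integral_solution_def)
  \<comment> \<open>Freezes the duality mapping at time \<open>s\<close>. The oscillation
    \<open>\<omega>\<close> stays a parameter: it is merely small for a continuous solution, but
    \<open>M * r\<close> for a Lipschitz one, which makes the error quadratic.\<close>
  also have "integral {s..s + r} (\<lambda>\<tau>. j (q - v \<tau>) w)
      \<le> integral {s..s + r} (\<lambda>\<tau>. j (q - v s) w + K * \<omega> * M)"
  proof (rule integral_le)
    show "(\<lambda>\<tau>. j (q - v \<tau>) w) integrable_on {s..s + r}"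
      using s by (intro integrable_continuous_interval continuous_on_j continuous_intros
        continuous_on_subset[OF cont]) auto
  next
    fix \<tau> assume "\<tau> \<in> {s..s + r}"
    then have "norm (v \<tau> - v s) \<le> \<omega>" using \<omega> by simp
    then have "K * norm (v \<tau> - v s) * norm w \<le> K * \<omega> * M"
      using K_pos w(2) M \<omega>0 by (intro mult_mono) auto
    then show "j (q - v \<tau>) w \<le> j (q - v s) w + K * \<omega> * M"
      using j_lip[of "q - v \<tau>" w "q - v s"] by (simp add: norm_minus_commute)
  qed auto
  finally have 1: "(norm (v (s + r) - q))\<^sup>2 - (norm (v s - q))\<^sup>2
      \<le> 2 * r * j (q - v s) w + 2 * r * (K * \<omega> * M)"
    using r by (simp add: algebra_simps)
  define D where "D = norm (v s - p)"
  have 2: "(norm (v s - q))\<^sup>2 + 2 * j (v s - q) (q - p) \<le> D\<^sup>2"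
    using norm_sq_lower[of "v s - q" "q - p"] by (simp add: D_def)
  have "j (v s - q) (q - p) = j (q - v s) (p - q)"
    using j_minus[of "q - v s" "q - p"] by (simp flip: blinfun.minus_right)
  also have "\<dots> = r * j (q - v s) w + j (q - v s) (p - q - r *\<^sub>R w)"
    by (simp add: blinfun.diff_right blinfun.scaleR_right)
  finally have 3: "j (v s - q) (q - p) = r * j (q - v s) w + j (q - v s) (p - q - r *\<^sub>R w)" .
  have "norm (q - v s) \<le> D + r * M"
    using norm_triangle_ineq[of "v s - p" "p - q"] w(3) by (simp add: D_def norm_minus_commute)
  then have "norm (q - v s) * norm (p - q - r *\<^sub>R w) \<le> (D + r * M) * (r * (r * M / \<theta>))"
    using w(4) by (intro mult_mono) (auto intro: order_trans[OF norm_ge_zero])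
  then have 4: "- j (q - v s) (p - q - r *\<^sub>R w) \<le> (D + r * M) * (r * (r * M / \<theta>))"
    using j_abs_le[of "q - v s" "p - q - r *\<^sub>R w"] by simp
  \<comment> \<open>The term linear in \<open>D\<close> is split by Young's inequality, so that the
    growth factor becomes \<open>1 + r\<^sup>2\<close> and the product of these factors stays
    bounded for square-summable steps.\<close>
  have "2 * ((D + r * M) * (r * (r * M / \<theta>))) = r\<^sup>2 * (2 * D * (M / \<theta>)) + r\<^sup>2 * (2 * M\<^sup>2) * (r / \<theta>)"
    by (simp add: power2_eq_square algebra_simps add_divide_distrib)
  also have "\<dots> \<le> r\<^sup>2 * (D\<^sup>2 + (M / \<theta>)\<^sup>2) + r\<^sup>2 * (2 * M\<^sup>2) * (1 / K)"
    using r \<theta>_pos K_pos sum_squares_bound[of D "M / \<theta>"]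
    by (intro add_mono mult_left_mono) (auto simp: field_simps)
  finally have "2 * ((D + r * M) * (r * (r * M / \<theta>))) \<le> r\<^sup>2 * D\<^sup>2 + r\<^sup>2 * step_const M"
    by (simp add: step_const_def algebra_simps)
  then have "(norm (v (s + r) - q))\<^sup>2 \<le> D\<^sup>2 + r\<^sup>2 * D\<^sup>2 + 2 * r * (K * \<omega> * M) + r\<^sup>2 * step_const M"
    using 1 2 3 4 by linarith
  then show ?thesis by (simp add: q_def D_def algebra_simps)
qed

end

section \<open>Uniqueness and contraction of integral solutions\<close>

text \<open>Since \<open>1 + \<alpha> i \<le> exp (\<alpha> i)\<close> and all exponentials are at
  least 1, each \<open>\<beta> i\<close> may be charged the full product.\<close>

lemma discrete_gronwall:
  fixes a \<alpha> \<beta> :: "nat \<Rightarrow> real"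
  assumes step: "\<And>i. i < n \<Longrightarrow> a (Suc i) \<le> (1 + \<alpha> i) * a i + \<beta> i"
    and "a 0 \<ge> 0" "\<And>i. \<alpha> i \<ge> 0" "\<And>i. \<beta> i \<ge> 0"
  shows "a n \<le> exp (\<Sum>i<n. \<alpha> i) * (a 0 + (\<Sum>i<n. \<beta> i))"
  using step
proof (induction n)
  case (Suc n)
  define E where "E = exp (\<Sum>i<n. \<alpha> i)"
  define P where "P = a 0 + (\<Sum>i<n. \<beta> i)"
  have E: "E \<ge> 1" using assms(3) by (simp add: E_def sum_nonneg)
  have P: "P \<ge> 0" using assms(2,4) by (simp add: P_def sum_nonneg)
  have IH: "a n \<le> E * P"
    unfolding E_def P_def by (rule Suc.IH) (use Suc.prems in simp)
  have "a (Suc n) \<le> (1 + \<alpha> n) * a n + \<beta> n" using Suc.prems by simp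
  also have "(1 + \<alpha> n) * a n \<le> (1 + \<alpha> n) * (E * P)"
    using IH assms(3) by (intro mult_left_mono add_nonneg_nonneg) auto
  also have "(1 + \<alpha> n) * (E * P) \<le> exp (\<alpha> n) * (E * P)"
    using E P by (intro mult_right_mono exp_ge_add_one_self) auto
  also have "\<beta> n \<le> exp (\<alpha> n) * (E * \<beta> n)"
  proof -
    have "1 * 1 \<le> exp (\<alpha> n) * E"
      using E assms(3)[of n] by (intro mult_mono) auto
    then have "1 * \<beta> n \<le> (exp (\<alpha> n) * E) * \<beta> n"
      using assms(4)[of n] by (intro mult_right_mono) auto
    then show ?thesis by (simp add: mult.assoc)
  qed
  finally show ?case
    by (simp add: E_def P_def exp_add algebra_simps)
qed simp

context forward_backward
begin

lemma fb_iterate_slow: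
  assumes p: "p \<in> slow M" and r: "r > 0" "K * r \<le> \<theta>"
  shows "(T r ^^ n) p \<in> slow M"
  by (induction n) (use assms fb_step_slow in auto)

lemma fb_iterate_dist:
  assumes p: "p \<in> slow M" and r: "r > 0" "K * r \<le> \<theta>"
  shows "norm ((T r ^^ (m + n)) p - (T r ^^ m) p) \<le> real n * r * M"
proof (induction n)
  case (Suc n)
  have "norm ((T r ^^ (m + n)) p - T r ((T r ^^ (m + n)) p)) \<le> r * M"
    using fb_step_slow(2)[OF fb_iterate_slow[OF assms] r] .
  then show ?case
    using Suc norm_triangle_ineq[of "T r ((T r ^^ (m + n)) p) - (T r ^^ (m + n)) p"
        "(T r ^^ (m + n)) p - (T r ^^ m) p"]
    by (simp add: norm_minus_commute algebra_simps)
qed simp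

lemma fb_iterate_nonexpansive:
  assumes "r > 0" "K * r \<le> \<theta>"
  shows "norm ((T r ^^ n) p - (T r ^^ n) q) \<le> norm (p - q)"
proof (induction n)
  case (Suc n)
  then show ?case
    using fb_step_nonexpansive[OF assms, of "(T r ^^ n) p" "(T r ^^ n) q"] by simp
qed simp

text \<open>Here the solution is only continuous. Its oscillation on each step is at most some
  \<open>\<eta>\<close>, so \<open>m\<close> steps of size \<open>t / m\<close> cost
  \<open>2 * t * K * \<eta> * M\<close> in all, and the other errors carry a factor
  \<open>t / real m\<close>. The iterates do not depend on \<open>v\<close>, which is what makes
  solutions comparable with each other.\<close>

lemma integral_solution_approx:
  assumes v: "integral_solution C x v" and t: "t > 0" and p: "p \<in> slow M" and \<epsilon>: "\<epsilon> > 0"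
  shows "eventually (\<lambda>m. norm (v t - (T (t / real m) ^^ m) p) \<le> norm (x - p) + \<epsilon>) sequentially"
proof -
  have M: "M \<ge> 0" using p by (rule slow_nonneg)
  define D where "D = norm (x - p)"
  \<comment> \<open>Chosen so that the accumulated cost \<open>2 * t * K * M * \<eta>\<close> stays
    below \<open>\<epsilon>\<^sup>2\<close>; the summand 1 covers \<open>M = 0\<close>.\<close>
  define \<eta> where "\<eta> = \<epsilon>\<^sup>2 / (2 * (t * K * M) + 1)"
  have den: "2 * (t * K * M) + 1 > 0" using t K_pos M by (intro add_nonneg_pos) auto
  have \<eta>: "\<eta> > 0" using den \<epsilon> by (simp add: \<eta>_def)
  have "2 * (t * K * M) * \<eta> < \<epsilon>\<^sup>2"
    using den \<epsilon> by (simp add: \<eta>_def field_simps)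
  then have small: "t * (2 * (K * \<eta> * M)) < \<epsilon>\<^sup>2" by (simp add: algebra_simps)
  have cont: "continuous_on {0..} v" and v0: "v 0 = x"
    using v by (auto simp: integral_solution_def)
  have "uniformly_continuous_on {0..t} v"
    using cont by (intro compact_uniformly_continuous continuous_on_subset[OF cont]) auto
  then obtain d where d: "d > 0" "\<And>s s'. s \<in> {0..t} \<Longrightarrow> s' \<in> {0..t} \<Longrightarrow> \<bar>s - s'\<bar> < d \<Longrightarrow> norm (v s - v s') < \<eta>"
    using \<eta> unfolding uniformly_continuous_on_def dist_norm real_norm_def by metis
  have tm: "(\<lambda>m. t / real m) \<longlonglongrightarrow> 0" by (rule lim_const_over_n)
  define R where "R m = exp (t * (t / real m)) * (D\<^sup>2 + t * (2 * (K * \<eta> * M)) + t * (t / real m) * step_const M)" for m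
  have "R \<longlonglongrightarrow> exp (t * 0) * (D\<^sup>2 + t * (2 * (K * \<eta> * M)) + t * 0 * step_const M)"
    unfolding R_def by (intro tendsto_intros tm)
  moreover have "exp (t * 0) * (D\<^sup>2 + t * (2 * (K * \<eta> * M)) + t * 0 * step_const M) < D\<^sup>2 + \<epsilon>\<^sup>2"
    using small by simp
  ultimately have "eventually (\<lambda>m. R m < D\<^sup>2 + \<epsilon>\<^sup>2) sequentially"
    by (rule order_tendstoD)
  moreover have "eventually (\<lambda>m. t / real m < d) sequentially"
    using order_tendstoD(2)[OF tm d(1)] .
  moreover have "eventually (\<lambda>m. t / real m < \<theta> / K) sequentially"
    using order_tendstoD(2)[OF tm, of "\<theta> / K"] \<theta>_pos K_pos by simp
  ultimately show ?thesis
    using eventually_gt_at_top[of 0]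
  proof eventually_elim
    case (elim m)
    define r where "r = t / real m"
    have r: "r > 0" "K * r \<le> \<theta>"
      using elim t K_pos by (auto simp: r_def field_simps)
    have mr: "real m * r = t" using elim by (simp add: r_def)
    define a where "a i = (norm (v (real i * r) - (T r ^^ i) p))\<^sup>2" for i
    have "a m \<le> exp (\<Sum>i<m. r\<^sup>2) * (a 0 + (\<Sum>i<m. 2 * r * (K * \<eta> * M) + r\<^sup>2 * step_const M))"
    proof (rule discrete_gronwall)
      fix i assume i: "i < m"
      have i': "real i * r + r \<le> t"
      proof -
        have "real (Suc i) * r \<le> real m * r" using i r by (intro mult_right_mono) auto
        then show ?thesis unfolding mr by (simp add: algebra_simps)
      qed
      have "norm (v \<tau> - v (real i * r)) \<le> \<eta>" if "real i * r \<le> \<tau>" "\<tau> \<le> real i * r + r" for \<tau>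
      proof (rule less_imp_le, rule d(2))
        have "0 \<le> real i * r" using r by simp
        then have "0 \<le> \<tau>" "\<tau> \<le> t" "real i * r \<le> t"
          using that i' r(1) by linarith+
        then show "\<tau> \<in> {0..t}" "real i * r \<in> {0..t}" using r by auto
        show "\<bar>\<tau> - real i * r\<bar> < d" using that elim by (auto simp: r_def)
      qed
      from integral_solution_step[OF v _ fb_iterate_slow[OF p r] r this, of i]
      show "a (Suc i) \<le> (1 + r\<^sup>2) * a i + (2 * r * (K * \<eta> * M) + r\<^sup>2 * step_const M)"
        using r by (simp add: a_def algebra_simps)
    qed (use r K_pos \<eta> M step_const_nonneg in \<open>auto simp: a_def\<close>)
    also have "\<dots> = R m"
      unfolding R_def using mr elim
      by (simp add: a_def v0 D_def power2_eq_square r_def field_simps)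
    also have "\<dots> \<le> D\<^sup>2 + \<epsilon>\<^sup>2" using elim by simp
    also have "\<dots> \<le> (D + \<epsilon>)\<^sup>2" using \<epsilon> by (simp add: D_def power2_sum)
    finally have "norm (v t - (T r ^^ m) p) \<le> D + \<epsilon>"
      using \<epsilon> mr unfolding a_def by (auto simp: D_def intro: power2_le_imp_le)
    then show ?case by (simp add: r_def D_def)
  qed
qed

lemma eventually_small_step:
  assumes "t > 0"
  shows "eventually (\<lambda>m. t / real m > 0 \<and> K * (t / real m) \<le> \<theta>) sequentially"
proof -
  have "eventually (\<lambda>m. t / real m < \<theta> / K) sequentially"
    using order_tendstoD(2)[OF lim_const_over_n[of t], of "\<theta> / K"] \<theta>_pos K_pos by simp
  then show ?thesis
    using eventually_gt_at_top[of 0]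
    by eventually_elim (use assms K_pos in \<open>auto simp: field_simps\<close>)
qed

lemma closure_domainE:
  assumes "x \<in> closure (op_domain A)" "\<epsilon> > 0"
  obtains p M where "p \<in> slow M" "norm (x - p) < \<epsilon>"
proof -
  obtain p where "p \<in> op_domain A" "dist p x < \<epsilon>"
    using assms closure_approachable by blast
  then show thesis
    using that domain_slow[of p] by (auto simp: dist_norm norm_minus_commute)
qed

text \<open>Both solutions are limits, up to the choice of nearby slow starting points, of the same
  nonexpansive iterations. Equal initial points give uniqueness.\<close>

lemma integral_solution_contraction:
  assumes v: "integral_solution C x v" and v': "integral_solution C x' v'"
    and x: "x \<in> closure (op_domain A)" and x': "x' \<in> closure (op_domain A)" and t: "t \<ge> 0"
  shows "norm (v t - v' t) \<le> norm (x - x')"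
proof (cases "t = 0")
  case True
  then show ?thesis using v v' by (simp add: integral_solution_def)
next
  case False
  with t have t: "t > 0" by simp
  show ?thesis
  proof (rule field_le_epsilon)
    fix e :: real assume e: "e > 0"
    \<comment> \<open>The distances from \<open>x\<close> to \<open>p\<close> and from
      \<open>x'\<close> to \<open>p'\<close> are paid twice each, the two approximation errors once
      each.\<close>
    define \<epsilon> where "\<epsilon> = e / 6"
    have \<epsilon>: "\<epsilon> > 0" using e by (simp add: \<epsilon>_def)
    obtain p M where p: "p \<in> slow M" "norm (x - p) < \<epsilon>"
      using closure_domainE[OF x \<epsilon>] .
    obtain p' M' where p': "p' \<in> slow M'" "norm (x' - p') < \<epsilon>"
      using closure_domainE[OF x' \<epsilon>] .
    have "eventually (\<lambda>m. norm (v t - v' t) \<le> norm (x - x') + e) sequentially"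
      using integral_solution_approx[OF v t p(1) \<epsilon>] integral_solution_approx[OF v' t p'(1) \<epsilon>]
        eventually_small_step[OF t]
    proof eventually_elim
      case (elim m)
      define q where "q = (T (t / real m) ^^ m) p"
      define q' where "q' = (T (t / real m) ^^ m) p'"
      have q: "norm (v t - q) \<le> norm (x - p) + \<epsilon>" "norm (v' t - q') \<le> norm (x' - p') + \<epsilon>"
        using elim by (simp_all add: q_def q'_def)
      have "norm (q - q') \<le> norm (p - p')"
        unfolding q_def q'_def using elim by (intro fb_iterate_nonexpansive) auto
      also have "p - p' = (x - x') + ((x' - p') - (x - p))" by simp
      also have "norm \<dots> \<le> norm (x - x') + (norm (x' - p') + norm (x - p))"
        by (intro norm_triangle_le add_left_mono norm_triangle_ineq4)
      finally have qq: "norm (q - q') \<le> norm (x - x') + (norm (x' - p') + norm (x - p))" .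
      have "v t - v' t = (q - q') + ((v t - q) - (v' t - q'))" by simp
      also have "norm \<dots> \<le> norm (q - q') + (norm (v t - q) + norm (v' t - q'))"
        by (intro norm_triangle_le add_left_mono norm_triangle_ineq4)
      finally show ?case
        using q qq p(2) p'(2) by (simp add: \<epsilon>_def)
    qed
    then show "norm (v t - v' t) \<le> norm (x - x') + e" by simp
  qed
qed

text \<open>An iterate of \<open>p\<close> with steps \<open>t / m\<close> serves as
  \<open>q\<close>: it inherits the bound \<open>M\<close>. This replaces the statement that
  \<open>v t\<close> itself lies in the domain, which would require a closedness argument.\<close>

lemma integral_solution_near_slow:
  assumes v: "integral_solution C x v" and t: "t \<ge> 0" and p: "p \<in> slow M" and \<epsilon>: "\<epsilon> > 0"
  shows "\<exists>q\<in>slow M. norm (v t - q) \<le> norm (x - p) + \<epsilon> \<and> norm (q - p) \<le> t * M"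
proof (cases "t = 0")
  case True
  then show ?thesis using v p \<epsilon> by (intro bexI[of _ p]) (auto simp: integral_solution_def)
next
  case False
  with t have t: "t > 0" by simp
  have "eventually (\<lambda>m. ?thesis) sequentially"
    using integral_solution_approx[OF v t p \<epsilon>] eventually_small_step[OF t] eventually_gt_at_top[of 0]
  proof eventually_elim
    case (elim m)
    have "norm ((T (t / real m) ^^ m) p - p) \<le> t * M"
      using fb_iterate_dist[OF p, of "t / real m" 0 m] elim by simp
    then show ?case
      using elim fb_iterate_slow[OF p, of "t / real m" m] by blast
  qed
  then show ?thesis by simp
qed

lemma integral_solution_in_closure:
  assumes v: "integral_solution C x v" and x: "x \<in> closure (op_domain A)" and t: "t \<ge> 0"
  shows "v t \<in> closure (op_domain A)"
  unfolding closure_approachable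
proof (intro allI impI)
  fix e :: real assume e: "e > 0"
  obtain p M where p: "p \<in> slow M" "norm (x - p) < e / 2"
    using closure_domainE[OF x, of "e / 2"] e by auto
  obtain q where "q \<in> slow M" "norm (v t - q) \<le> norm (x - p) + e / 2"
    using integral_solution_near_slow[OF v t p(1), of "e / 2"] e by auto
  then show "\<exists>q\<in>op_domain A. dist q (v t) < e"
    using p slow_subset_domain by (intro bexI[of _ q]) (auto simp: dist_norm norm_minus_commute)
qed

lemma integral_solution_shift:
  assumes v: "integral_solution C x v" and t: "t \<ge> 0"
  shows "integral_solution C (v t) (\<lambda>s. v (t + s))"
  unfolding integral_solution_def
proof (intro conjI allI impI ballI)
  have cont: "continuous_on {0..} v" using v by (simp add: integral_solution_def)
  show "continuous_on {0..} (\<lambda>s. v (t + s))"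
    using t by (intro continuous_on_compose2[OF cont] continuous_intros) auto
next
  fix s s' :: real and z y
  assume s: "0 \<le> s \<and> s < s'" and z: "z \<in> op_domain C" "y \<in> C z"
  have "integral {s..s'} (\<lambda>\<tau>. j (z - v (t + \<tau>)) y) = integral {t + s..t + s'} (\<lambda>\<tau>. j (z - v \<tau>) y)"
    using integral_shift_Icc_real[of s s' "\<lambda>\<tau>. j (z - v \<tau>) y" t] by (simp add: o_def add.commute)
  moreover have "(norm (v (t + s') - z))\<^sup>2 - (norm (v (t + s) - z))\<^sup>2
      \<le> 2 * integral {t + s..t + s'} (\<lambda>\<tau>. j (z - v \<tau>) y)"
    using v z s t by (simp add: integral_solution_def)
  ultimately show "(norm (v (t + s') - z))\<^sup>2 - (norm (v (t + s) - z))\<^sup>2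
      \<le> 2 * integral {s..s'} (\<lambda>\<tau>. j (z - v (t + \<tau>)) y)" by simp
qed simp

text \<open>The slow points near \<open>v h\<close> bound the displacement from time 0; contraction
  between \<open>v\<close> and its shift by \<open>h\<close> carries this bound to every later
  time.\<close>

lemma integral_solution_lipschitz:
  assumes v: "integral_solution C x v" and x: "x \<in> slow M" and s: "s \<ge> 0" and t: "t \<ge> 0"
  shows "norm (v s - v t) \<le> M * \<bar>s - t\<bar>"
proof -
  have xc: "x \<in> closure (op_domain A)"
    using x slow_subset_domain closure_subset by blast
  have start: "norm (v h - v 0) \<le> M * h" if h: "h \<ge> 0" for h
  proof (rule field_le_epsilon)
    fix e :: real assume "e > 0"
    then obtain q where "norm (v h - q) \<le> e" "norm (q - x) \<le> h * M"
      using integral_solution_near_slow[OF v h x] by auto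
    then show "norm (v h - v 0) \<le> M * h + e"
      using v norm_triangle_ineq[of "v h - q" "q - x"] by (simp add: integral_solution_def mult.commute)
  qed
  have le: "norm (v (s + h) - v s) \<le> M * h" if "s \<ge> 0" "h \<ge> 0" for s h
  proof -
    have "norm (v (h + s) - v s) \<le> norm (v h - x)"
      using integral_solution_contraction[OF integral_solution_shift[OF v that(2)] v
          integral_solution_in_closure[OF v xc that(2)] xc that(1)] .
    also have "\<dots> \<le> M * h" using start[OF that(2)] v by (simp add: integral_solution_def)
    finally show ?thesis by (simp add: add.commute)
  qed
  show ?thesis
    using le[of s "t - s"] le[of t "s - t"] s t
    by (cases "s \<le> t") (auto simp: norm_minus_commute)
qed

end

section \<open>Existence of integral solutions\<close>

lemma geometric_increments_limit:
  fixes f :: "nat \<Rightarrow> 'a::banach"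
  assumes inc: "\<And>k. norm (f (Suc k) - f k) \<le> R * \<rho> ^ k" and \<rho>: "0 \<le> \<rho>" "\<rho> < 1"
  shows "\<exists>l. f \<longlonglongrightarrow> l \<and> (\<forall>k. norm (f k - l) \<le> R * \<rho> ^ k / (1 - \<rho>))"
proof -
  have R: "R \<ge> 0" using order_trans[OF norm_ge_zero inc[of 0]] by simp
  \<comment> \<open>The exact factor \<open>1 - \<rho> ^ n\<close> lets the induction close.\<close>
  have partial: "norm (f (k + n) - f k) \<le> R * \<rho> ^ k * (1 - \<rho> ^ n) / (1 - \<rho>)" for k n
  proof (induction n)
    case (Suc n)
    have "norm (f (k + Suc n) - f k) \<le> R * \<rho> ^ (k + n) + R * \<rho> ^ k * (1 - \<rho> ^ n) / (1 - \<rho>)"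
      using norm_triangle_ineq[of "f (Suc (k + n)) - f (k + n)" "f (k + n) - f k"] inc[of "k + n"] Suc
      by simp
    also have "\<dots> = R * \<rho> ^ k * (1 - \<rho> ^ Suc n) / (1 - \<rho>)"
      using \<rho> by (simp add: field_simps power_add)
    finally show ?case .
  qed simp
  have bound: "norm (f (k + n) - f k) \<le> R * \<rho> ^ k / (1 - \<rho>)" for k n
  proof -
    have "R * \<rho> ^ k * (1 - \<rho> ^ n) / (1 - \<rho>) \<le> R * \<rho> ^ k * 1 / (1 - \<rho>)"
      using R \<rho> by (intro divide_right_mono mult_left_mono) auto
    then show ?thesis using partial[of k n] by simp
  qed
  have "summable (\<lambda>k. R * \<rho> ^ k)"
    by (rule summable_mult, rule summable_geometric) (use \<rho> in simp)
  then have "summable (\<lambda>k. f (Suc k) - f k)"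
    by (rule summable_comparison_test'[where N = 0]) (rule inc)
  then have "convergent (\<lambda>n. \<Sum>k<n. f (Suc k) - f k)"
    by (simp add: summable_iff_convergent)
  then have "convergent (\<lambda>n. f n - f 0)"
    by (simp add: sum_lessThan_telescope)
  then obtain l' where "(\<lambda>n. f n - f 0) \<longlonglongrightarrow> l'" by (auto simp: convergent_def)
  then have lim: "f \<longlonglongrightarrow> l' + f 0"
    using tendsto_add[of "\<lambda>n. f n - f 0" l' sequentially "\<lambda>_. f 0" "f 0"] by simp
  have "norm (f k - (l' + f 0)) \<le> R * \<rho> ^ k / (1 - \<rho>)" for k
  proof (rule LIMSEQ_le_const2)
    show "(\<lambda>n. norm (f k - f (n + k))) \<longlonglongrightarrow> norm (f k - (l' + f 0))"
      using lim by (intro tendsto_intros LIMSEQ_ignore_initial_segment)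
    show "\<exists>N. \<forall>n\<ge>N. norm (f k - f (n + k)) \<le> R * \<rho> ^ k / (1 - \<rho>)"
      using bound[of k] by (auto simp: norm_minus_commute add.commute)
  qed
  with lim show ?thesis by blast
qed

lemma nat_floor_div_bounds:
  fixes t h :: real
  assumes "t \<ge> 0" "h > 0"
  shows "real (nat \<lfloor>t / h\<rfloor>) * h \<le> t" "t < real (nat \<lfloor>t / h\<rfloor>) * h + h"
proof -
  have "of_int \<lfloor>t / h\<rfloor> \<le> t / h" "t / h < of_int \<lfloor>t / h\<rfloor> + 1" by linarith+
  moreover have "real (nat \<lfloor>t / h\<rfloor>) = of_int \<lfloor>t / h\<rfloor>" using assms by simp
  ultimately show "real (nat \<lfloor>t / h\<rfloor>) * h \<le> t" "t < real (nat \<lfloor>t / h\<rfloor>) * h + h"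
    using assms by (simp_all only: pos_le_divide_eq pos_divide_less_eq distrib_right mult_1)
qed

context forward_backward
begin

text \<open>Each step of size \<open>r\<close>, compared with two of size \<open>r / 2\<close>, adds
  O(\<open>r\<^sup>2\<close>) to the squared distance. As \<open>real n * r \<le> S\<close>, the
  total is O(\<open>r\<close>), hence a distance of order \<open>sqrt r\<close>. All iterates stay
  within \<open>S * M\<close> of \<open>p\<close>, which bounds the pairing with the
  residuals.\<close>

lemma fb_iterate_halving:
  assumes p: "p \<in> slow M" and r: "r > 0" "K * r \<le> \<theta>" and n: "real n * r \<le> S"
  shows "(norm ((T r ^^ n) p - (T (r / 2) ^^ (2 * n)) p))\<^sup>2
    \<le> real n * (r\<^sup>2 * (K * M\<^sup>2 + 6 * S * M\<^sup>2 / \<theta>))"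
  using n
proof (induction n)
  case (Suc n)
  have M: "M \<ge> 0" using p by (rule slow_nonneg)
  have r2: "r / 2 > 0" "K * (r / 2) \<le> \<theta>" using r \<theta>_pos by auto
  define P where "P = (T r ^^ n) p"
  define Q where "Q = (T (r / 2) ^^ (2 * n)) p"
  define x where "x = T r P"
  define y1 where "y1 = T (r / 2) Q"
  define y where "y = T (r / 2) y1"
  have slow: "P \<in> slow M" "Q \<in> slow M" "y1 \<in> slow M"
    using fb_iterate_slow[OF p r] fb_iterate_slow[OF p r2] fb_step_slow(1)[OF _ r2]
    by (auto simp: P_def Q_def y1_def)
  obtain w where w: "w \<in> C x" "norm w \<le> M" "norm (P - x - r *\<^sub>R w) \<le> r * (r * M / \<theta>)"
    using fb_step_slowE[OF slow(1) r] unfolding x_def by metis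
  obtain w1 where w1: "w1 \<in> C y1" "norm w1 \<le> M"
      "norm (Q - y1 - (r / 2) *\<^sub>R w1) \<le> r / 2 * (r / 2 * M / \<theta>)"
    using fb_step_slowE[OF slow(2) r2] unfolding y1_def by metis
  obtain w2 where w2: "w2 \<in> C y" "norm w2 \<le> M" "norm (y1 - y) \<le> r / 2 * M"
      "norm (y1 - y - (r / 2) *\<^sub>R w2) \<le> r / 2 * (r / 2 * M / \<theta>)"
    using fb_step_slowE[OF slow(3) r2] unfolding y_def by metis
  define e where "e = P - x - r *\<^sub>R w"
  define e1 where "e1 = Q - y1 - (r / 2) *\<^sub>R w1"
  define e2 where "e2 = y1 - y - (r / 2) *\<^sub>R w2"
  define E where "E = e - e1 - e2"
  have "norm E \<le> norm e + norm e1 + norm e2"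
    unfolding E_def using norm_triangle_ineq4[of "e - e1" e2] norm_triangle_ineq4[of e e1] by linarith
  also have "\<dots> \<le> r * (r * M / \<theta>) + r / 2 * (r / 2 * M / \<theta>) + r / 2 * (r / 2 * M / \<theta>)"
    unfolding e_def e1_def e2_def by (intro add_mono w(3) w1(3) w2(4))
  \<comment> \<open>One full step contributes 1, the two half steps 1/4 each.\<close>
  also have "\<dots> = 3 / 2 * (r * r * M / \<theta>)" by (simp add: field_simps)
  finally have E: "norm E \<le> 3 / 2 * (r * r * M / \<theta>)" .
  have "norm (x - p) \<le> real (Suc n) * r * M"
    using fb_iterate_dist[OF p r, of 0 "Suc n"] by (simp add: x_def P_def)
  moreover have "norm (y - p) \<le> real (2 * Suc n) * (r / 2) * M"
    using fb_iterate_dist[OF p r2, of 0 "2 * Suc n"] by (simp add: y_def y1_def Q_def)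
  moreover have "real (2 * Suc n) * (r / 2) * M = real (Suc n) * r * M" by simp
  ultimately have "norm (x - y) \<le> 2 * (real (Suc n) * r * M)"
    using norm_triangle_ineq4[of "x - p" "y - p"] by (simp only: diff_diff_eq2 diff_add_cancel)
  also have "\<dots> \<le> 2 * (S * M)"
    using Suc.prems M by (intro mult_left_mono mult_right_mono) auto
  finally have xy: "norm (x - y) \<le> 2 * (S * M)" .
  have "- j (x - y) E \<le> norm (x - y) * norm E"
    using j_abs_le[of "x - y" E] by linarith
  also have "\<dots> \<le> 2 * (S * M) * (3 / 2 * (r * r * M / \<theta>))"
    by (rule mult_mono[OF xy E order_trans[OF norm_ge_zero xy]]) simp
  finally have jE: "- j (x - y) E \<le> 3 * (S * M) * (r * r * M / \<theta>)" by (simp add: ac_simps)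
  have j2: "0 \<le> j (x - y) (w - w2)"
    using j_accretive_sum[OF w(1) w2(1)] .
  have "norm (w - w1) \<le> 2 * M"
    using norm_triangle_ineq4[of w w1] w(2) w1(2) by linarith
  \<comment> \<open>Accretivity pairs \<open>w - w1\<close> with \<open>x - y1\<close>, not with the
    endpoint difference \<open>x - y\<close>; moving the duality mapping from \<open>y1\<close> to
    \<open>y\<close> costs this much.\<close>
  then have "K * norm (y1 - y) * norm (w - w1) \<le> K * (r / 2 * M) * (2 * M)"
    using w2(3) K_pos r M by (intro mult_mono) auto
  then have j1: "- (K * r * M * M) \<le> j (x - y) (w - w1)"
    using j_lip[of "x - y" "w - w1" "x - y1"] j_accretive_sum[OF w(1) w1(1)] by (simp add: mult.assoc)
  have decomp: "(P - Q) - (x - y) = (r / 2) *\<^sub>R (w - w1) + (r / 2) *\<^sub>R (w - w2) + E"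
  proof -
    have "r *\<^sub>R w = (r / 2) *\<^sub>R w + (r / 2) *\<^sub>R w"
      by (simp flip: scaleR_left_distrib)
    then show ?thesis by (simp add: E_def e_def e1_def e2_def algebra_simps)
  qed
  have "j (x - y) ((P - Q) - (x - y)) = r / 2 * j (x - y) (w - w1) + r / 2 * j (x - y) (w - w2) + j (x - y) E"
    unfolding decomp by (simp only: blinfun.add_right blinfun.scaleR_right real_scaleR_def)
  moreover have "r / 2 * j (x - y) (w - w1) \<ge> r / 2 * (- (K * r * M * M))"
    using j1 r by (intro mult_left_mono) auto
  moreover have "r / 2 * j (x - y) (w - w2) \<ge> 0"
    using j2 r by simp
  ultimately have "- (2 * j (x - y) ((P - Q) - (x - y)))
      \<le> r * (K * r * M * M) + 2 * (3 * (S * M) * (r * r * M / \<theta>))"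
    using jE by linarith
  moreover have "(norm (x - y))\<^sup>2 + 2 * j (x - y) ((P - Q) - (x - y)) \<le> (norm (P - Q))\<^sup>2"
    using norm_sq_lower[of "x - y" "(P - Q) - (x - y)"] by simp
  ultimately have "(norm (x - y))\<^sup>2
      \<le> (norm (P - Q))\<^sup>2 + (r * (K * r * M * M) + 2 * (3 * (S * M) * (r * r * M / \<theta>)))"
    by linarith
  also have "r * (K * r * M * M) + 2 * (3 * (S * M) * (r * r * M / \<theta>))
      = r\<^sup>2 * (K * M\<^sup>2 + 6 * S * M\<^sup>2 / \<theta>)"
    by (simp add: power2_eq_square algebra_simps)
  also have "(norm (P - Q))\<^sup>2 \<le> real n * (r\<^sup>2 * (K * M\<^sup>2 + 6 * S * M\<^sup>2 / \<theta>))"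
    unfolding P_def Q_def using Suc.prems r by (intro Suc.IH) (auto simp: algebra_simps)
  finally have "(norm (x - y))\<^sup>2 \<le> real (Suc n) * (r\<^sup>2 * (K * M\<^sup>2 + 6 * S * M\<^sup>2 / \<theta>))"
    by (simp only: of_nat_Suc distrib_right mult_1) linarith
  then show ?case by (simp add: x_def y_def y1_def P_def Q_def)
qed simp

definition step_path :: "'a \<Rightarrow> real \<Rightarrow> real \<Rightarrow> 'a" where
  "step_path p h t = (T h ^^ nat \<lfloor>t / h\<rfloor>) p"

lemma step_path_lipschitz:
  assumes p: "p \<in> slow M" and r: "r > 0" "K * r \<le> \<theta>" and st: "0 \<le> s" "s \<le> t"
  shows "norm (step_path p r t - step_path p r s) \<le> M * (t - s + r)"
proof -
  have M: "M \<ge> 0" using p by (rule slow_nonneg)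
  define m where "m = nat \<lfloor>s / r\<rfloor>"
  define n where "n = nat \<lfloor>t / r\<rfloor>"
  have mn: "m \<le> n"
    unfolding m_def n_def using st r by (intro nat_mono floor_mono divide_right_mono) auto
  have "real n * r \<le> t" "s < real m * r + r"
    using nat_floor_div_bounds[of t r] nat_floor_div_bounds[of s r] st r by (auto simp: m_def n_def)
  then have "real (n - m) * r \<le> t - s + r"
    using mn by (simp add: of_nat_diff algebra_simps)
  then have "real (n - m) * r * M \<le> (t - s + r) * M"
    using M by (rule mult_right_mono)
  moreover have "norm ((T r ^^ (m + (n - m))) p - (T r ^^ m) p) \<le> real (n - m) * r * M"
    by (rule fb_iterate_dist[OF p r])
  ultimately show ?thesis
    using mn by (simp add: step_path_def m_def n_def mult.commute)
qed

lemma step_path_halving: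
  assumes p: "p \<in> slow M" and r: "r > 0" "K * r \<le> \<theta>" and t: "0 \<le> t" "t \<le> S"
  shows "norm (step_path p (r / 2) t - step_path p r t)
    \<le> sqrt (S * (K * M\<^sup>2 + 6 * S * M\<^sup>2 / \<theta>)) * sqrt r + r * M"
proof -
  have M: "M \<ge> 0" using p by (rule slow_nonneg)
  have r2: "r / 2 > 0" "K * (r / 2) \<le> \<theta>" using r \<theta>_pos by auto
  define c where "c = K * M\<^sup>2 + 6 * S * M\<^sup>2 / \<theta>"
  have c: "c \<ge> 0" using K_pos \<theta>_pos t by (simp add: c_def)
  define m where "m = nat \<lfloor>t / r\<rfloor>"
  define n where "n = nat \<lfloor>t / (r / 2)\<rfloor>"
  have mb: "real m * r \<le> t" "t < real m * r + r"
    using nat_floor_div_bounds[of t r] t r by (auto simp: m_def)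
  have nb: "real n * (r / 2) \<le> t" "t < real n * (r / 2) + r / 2"
    using nat_floor_div_bounds[of t "r / 2"] t r by (auto simp: n_def)
  \<comment> \<open>Rounding down leaves two cases, \<open>n = 2 * m\<close> and
    \<open>n = 2 * m + 1\<close>; the possible extra half step moves by at most
    \<open>r * M\<close>.\<close>
  have "real (2 * m) * r < real (n + 1) * r" "real n * r < real (2 * m + 2) * r"
    using mb nb by (auto simp: algebra_simps)
  then have "real (2 * m) < real (n + 1)" "real n < real (2 * m + 2)"
    using r by (simp_all only: mult_less_cancel_right_pos)
  then have "2 * m \<le> n" "n - 2 * m \<le> 1" by linarith+
  have "norm ((T (r / 2) ^^ (2 * m + (n - 2 * m))) p - (T (r / 2) ^^ (2 * m)) p)
      \<le> real (n - 2 * m) * (r / 2) * M"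
    by (rule fb_iterate_dist[OF p r2])
  also have "\<dots> \<le> 1 * r * M"
    using \<open>n - 2 * m \<le> 1\<close> r M by (intro mult_mono) auto
  finally have 1: "norm ((T (r / 2) ^^ n) p - (T (r / 2) ^^ (2 * m)) p) \<le> r * M"
    using \<open>2 * m \<le> n\<close> by simp
  have "(norm ((T r ^^ m) p - (T (r / 2) ^^ (2 * m)) p))\<^sup>2 \<le> real m * (r\<^sup>2 * c)"
    unfolding c_def using mb t by (intro fb_iterate_halving[OF p r]) auto
  also have "\<dots> = (real m * r) * (r * c)" by (simp add: power2_eq_square)
  also have "\<dots> \<le> S * (r * c)"
    using mb t r c by (intro mult_right_mono) auto
  finally have "norm ((T r ^^ m) p - (T (r / 2) ^^ (2 * m)) p) \<le> sqrt (S * (r * c))"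
    by (rule real_le_rsqrt)
  also have "\<dots> = sqrt (S * c) * sqrt r"
    by (simp add: real_sqrt_mult ac_simps)
  finally have 2: "norm ((T r ^^ m) p - (T (r / 2) ^^ (2 * m)) p) \<le> sqrt (S * c) * sqrt r" .
  show ?thesis
    using 1 2 norm_triangle_ineq4[of "(T (r / 2) ^^ n) p - (T (r / 2) ^^ (2 * m)) p"
        "(T r ^^ m) p - (T (r / 2) ^^ (2 * m)) p"]
    by (simp add: step_path_def m_def n_def c_def)
qed

text \<open>The integral inequality for the iterates, with the integrand already taken along the
  limit \<open>u\<close>. Accretivity replaces \<open>w\<close> by \<open>y\<close>; the error per
  step is \<open>r\<close> times a quantity that vanishes with \<open>\<delta>\<close> and
  \<open>r\<close>, so its sum over a bounded time vanishes too. The primitive \<open>G\<close>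
  makes the integrals telescope.\<close>

lemma step_path_integral_estimate:
  assumes p: "p \<in> slow M" and r: "r > 0" "K * r \<le> \<theta>"
    and u: "\<And>s t. s \<ge> 0 \<Longrightarrow> t \<ge> 0 \<Longrightarrow> norm (u s - u t) \<le> M * \<bar>s - t\<bar>"
    and near: "\<And>t. 0 \<le> t \<Longrightarrow> t \<le> S \<Longrightarrow> norm (step_path p r t - u t) \<le> \<delta>"
    and y: "y \<in> C z" and mn: "m \<le> n" "real n * r \<le> S"
  defines "x \<equiv> \<lambda>i. (T r ^^ i) p"
    and "G \<equiv> \<lambda>t. integral {0..t} (\<lambda>\<tau>. j (z - u \<tau>) y)"
  shows "(norm (x n - z))\<^sup>2 - (norm (x m - z))\<^sup>2
    \<le> 2 * (G (real n * r) - G (real m * r))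
      + real (n - m) * (r * (2 * (K * (\<delta> + M * r) * norm y) + 2 * (norm (p - z) + S * M) * (r * M / \<theta>)))"
  using mn
proof (induction n rule: dec_induct)
  case (step n)
  have M: "M \<ge> 0" using p by (rule slow_nonneg)
  have cont: "continuous_on {0..} u"
    by (rule lipschitz_on_continuous_on[where L = M])
      (use u M in \<open>auto intro!: lipschitz_onI simp: dist_norm\<close>)
  define a where "a = real n * r"
  define b where "b = real (Suc n) * r"
  have ab: "0 \<le> a" "b = a + r" "b \<le> S" using r step.prems by (auto simp: a_def b_def algebra_simps)
  obtain w where w: "w \<in> C (x (Suc n))" "norm (x n - x (Suc n) - r *\<^sub>R w) \<le> r * (r * M / \<theta>)"
    using fb_step_slowE[OF fb_iterate_slow[OF p r, of n] r] by (auto simp: x_def)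
  define d where "d = x (Suc n) - z"
  define e where "e = x n - x (Suc n) - r *\<^sub>R w"
  have "norm (x (Suc n) - p) \<le> real (Suc n) * r * M"
    using fb_iterate_dist[OF p r, of 0 "Suc n"] by (simp add: x_def)
  also have "\<dots> \<le> S * M"
    using step.prems M by (intro mult_right_mono) auto
  finally have "norm d \<le> norm (p - z) + S * M"
    using norm_triangle_ineq[of "x (Suc n) - p" "p - z"] by (simp add: d_def)
  then have "norm d * norm e \<le> (norm (p - z) + S * M) * (r * (r * M / \<theta>))"
    using w(2) by (intro mult_mono) (auto simp: e_def intro: order_trans[OF norm_ge_zero])
  then have je: "- j d e \<le> (norm (p - z) + S * M) * (r * (r * M / \<theta>))"
    using j_abs_le[of d e] by linarith
  have "j d y \<le> j d w"
    using j_accretive_sum[OF w(1) y] by (simp add: d_def blinfun.diff_right)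
  then have jw: "r * j d y \<le> r * j d w"
    using r by simp
  have "x n - z = d + (r *\<^sub>R w + e)" by (simp add: d_def e_def)
  then have "(norm d)\<^sup>2 + 2 * (r * j d w + j d e) \<le> (norm (x n - z))\<^sup>2"
    using norm_sq_lower[of d "r *\<^sub>R w + e"] by (simp add: blinfun.add_right blinfun.scaleR_right)
  moreover define F where "F = (norm (p - z) + S * M) * (r * (r * M / \<theta>))"
  ultimately have 1: "(norm d)\<^sup>2 - (norm (x n - z))\<^sup>2 \<le> 2 * (- (r * j d y)) + 2 * F"
    using je[folded F_def] jw by argo
  have "integral {a..b} (\<lambda>\<tau>. - j d y - K * (\<delta> + M * r) * norm y) \<le> integral {a..b} (\<lambda>\<tau>. j (z - u \<tau>) y)"
  proof (rule integral_le)
    show "(\<lambda>\<tau>. j (z - u \<tau>) y) integrable_on {a..b}"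
      using ab by (intro integrable_continuous_interval continuous_on_j continuous_intros
        continuous_on_subset[OF cont]) auto
  next
    fix \<tau> assume \<tau>: "\<tau> \<in> {a..b}"
    have "norm (u b - u \<tau>) \<le> M * \<bar>b - \<tau>\<bar>"
      using \<tau> ab r by (intro u) auto
    also have "\<dots> \<le> M * r"
      using \<tau> ab M by (intro mult_left_mono) auto
    finally have "norm (u b - u \<tau>) \<le> M * r" .
    moreover have "norm (x (Suc n) - u b) \<le> \<delta>"
    proof -
      \<comment> \<open>The right endpoint \<open>b\<close> is a grid point, where the step path
        already takes the new value \<open>x (Suc n)\<close>.\<close>
      have "nat \<lfloor>b / r\<rfloor> = Suc n" using r by (simp add: b_def del: of_nat_Suc)
      then show ?thesis using near[of b] ab r by (simp add: step_path_def x_def)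
    qed
    ultimately have "norm (x (Suc n) - u \<tau>) \<le> \<delta> + M * r"
      using norm_triangle_ineq[of "x (Suc n) - u b" "u b - u \<tau>"] by simp
    then have "K * norm (x (Suc n) - u \<tau>) * norm y \<le> K * (\<delta> + M * r) * norm y"
      using K_pos by (intro mult_right_mono mult_left_mono) auto
    moreover have "- j d y = j (z - x (Suc n)) y"
      using j_minus[of d y] by (simp add: d_def)
    ultimately show "- j d y - K * (\<delta> + M * r) * norm y \<le> j (z - u \<tau>) y"
      using j_lip[of "z - x (Suc n)" y "z - u \<tau>"] by (simp add: norm_minus_commute)
  qed auto
  moreover have "G a + integral {a..b} (\<lambda>\<tau>. j (z - u \<tau>) y) = G b"
    unfolding G_def using ab r
    by (intro Henstock_Kurzweil_Integration.integral_combine integrable_continuous_interval continuous_on_j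
        continuous_intros continuous_on_subset[OF cont]) auto
  moreover have "integral {a..b} (\<lambda>\<tau>. - j d y - K * (\<delta> + M * r) * norm y)
      = - (r * j d y) - r * (K * (\<delta> + M * r) * norm y)"
    using ab r by (simp add: algebra_simps)
  ultimately have 2: "- (r * j d y) \<le> G b - G a + r * (K * (\<delta> + M * r) * norm y)"
    by linarith
  define err where "err = r * (2 * (K * (\<delta> + M * r) * norm y) + 2 * (norm (p - z) + S * M) * (r * M / \<theta>))"
  have err: "2 * (r * (K * (\<delta> + M * r) * norm y)) + 2 * F = err"
    by (simp add: err_def F_def algebra_simps)
  have arith: "l \<le> 2 * c + e"
    if "2 * s + 2 * f = e" "l \<le> 2 * (- a) + 2 * f" "- a \<le> c + s" for a c e f l s :: real
    using that by linarith
  have "(norm d)\<^sup>2 - (norm (x n - z))\<^sup>2 \<le> 2 * (G b - G a) + err"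
    using err 1 2 by (rule arith)
  moreover have "(norm (x n - z))\<^sup>2 - (norm (x m - z))\<^sup>2 \<le> 2 * (G a - G (real m * r)) + real (n - m) * err"
    unfolding err_def a_def using ab r by (intro step.IH) (simp add: a_def)
  ultimately have "(norm d)\<^sup>2 - (norm (x m - z))\<^sup>2 \<le> 2 * (G b - G (real m * r)) + (real (n - m) + 1) * err"
    by (simp add: algebra_simps)
  also have "real (n - m) + 1 = real (Suc n - m)"
    using step.hyps by (simp add: of_nat_diff)
  finally show ?case by (simp only: d_def b_def err_def)
qed simp

text \<open>The halving error is of order \<open>sqrt (h k)\<close>, a multiple of
  \<open>\<rho> ^ k\<close>, so the increments are geometric, uniformly on bounded time intervals.
  The limit inherits the Lipschitz bound and, grid point by grid point, the integral
  inequality.\<close>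

lemma integral_solution_exists_slow:
  assumes p: "p \<in> slow M"
  shows "\<exists>u. integral_solution C p u"
proof -
  have M: "M \<ge> 0" using p by (rule slow_nonneg)
  define h where "h k = \<theta> / K / 2 ^ k" for k
  define \<rho> where "\<rho> = sqrt (1 / 2)"
  have \<rho>: "0 \<le> \<rho>" "\<rho> < 1" by (auto simp: \<rho>_def)
  have h: "h k > 0" "K * h k \<le> \<theta>" for k
    using K_pos \<theta>_pos by (auto simp: h_def divide_le_eq mult_le_cancel_left1)
  have h_Suc: "h (Suc k) = h k / 2" for k by (simp add: h_def)
  have h_eq: "h k = \<theta> / K * (\<rho> ^ k)\<^sup>2" for k
  proof -
    have "(\<rho> ^ k)\<^sup>2 = (\<rho>\<^sup>2) ^ k" by (metis power_mult mult.commute)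
    also have "\<rho>\<^sup>2 = 1 / 2" by (simp add: \<rho>_def)
    finally show ?thesis by (simp add: h_def power_divide)
  qed
  have h0: "h \<longlonglongrightarrow> 0"
    using LIMSEQ_realpow_zero[of "1/2"] tendsto_mult[of "\<lambda>_. \<theta> / K" "\<theta> / K" sequentially "\<lambda>k. (1/2)^k" 0]
    by (simp add: h_def[abs_def] power_divide)
  define R where "R S = sqrt (S * (K * M\<^sup>2 + 6 * S * M\<^sup>2 / \<theta>)) * sqrt (\<theta> / K) + \<theta> / K * M" for S
  have inc: "norm (step_path p (h (Suc k)) t - step_path p (h k) t) \<le> R S * \<rho> ^ k"
    if "0 \<le> t" "t \<le> S" for t S k
  proof -
    have sq: "sqrt (h k) = sqrt (\<theta> / K) * \<rho> ^ k"
      unfolding h_eq real_sqrt_mult real_sqrt_abs using \<rho> by simp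
    \<comment> \<open>The term linear in \<open>h k\<close> decays like the square of
      \<open>\<rho> ^ k\<close> and is absorbed by the slower rate.\<close>
    have "(\<rho> ^ k)\<^sup>2 \<le> \<rho> ^ k"
      using \<rho> mult_left_mono[of "\<rho> ^ k" 1 "\<rho> ^ k"] by (simp add: power2_eq_square power_le_one)
    then have hk: "h k * M \<le> \<theta> / K * M * \<rho> ^ k"
      unfolding h_eq using \<theta>_pos K_pos M mult_left_mono[of "(\<rho> ^ k)\<^sup>2" "\<rho> ^ k" "\<theta> / K * M"]
      by (simp add: ac_simps)
    show ?thesis
      using step_path_halving[OF p h[of k] that] hk
      unfolding h_Suc sq R_def by (simp add: algebra_simps)
  qed
  define u where "u t = lim (\<lambda>k. step_path p (h k) t)" for t
  have lim: "(\<lambda>k. step_path p (h k) t) \<longlonglongrightarrow> u t"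
    and rate: "\<And>S k. t \<le> S \<Longrightarrow> norm (step_path p (h k) t - u t) \<le> R S * \<rho> ^ k / (1 - \<rho>)"
    if t: "0 \<le> t" for t
  proof -
    have *: "\<exists>l. (\<lambda>k. step_path p (h k) t) \<longlonglongrightarrow> l \<and>
        (\<forall>k. norm (step_path p (h k) t - l) \<le> R S * \<rho> ^ k / (1 - \<rho>))" if "t \<le> S" for S
      using inc[OF t that] \<rho> by (rule geometric_increments_limit)
    show "(\<lambda>k. step_path p (h k) t) \<longlonglongrightarrow> u t"
      using *[of t] unfolding u_def by (auto simp: limI)
    then show "norm (step_path p (h k) t - u t) \<le> R S * \<rho> ^ k / (1 - \<rho>)" if "t \<le> S" for S k
      using *[OF that] LIMSEQ_unique by blast
  qed
  have lip_le: "norm (u t - u s) \<le> M * (t - s)" if "0 \<le> s" "s \<le> t" for s t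
  proof (rule LIMSEQ_le)
    show "(\<lambda>k. norm (step_path p (h k) t - step_path p (h k) s)) \<longlonglongrightarrow> norm (u t - u s)"
      using that by (intro tendsto_intros lim) auto
    have "(\<lambda>k. M * (t - s + h k)) \<longlonglongrightarrow> M * (t - s + 0)"
      by (intro tendsto_intros h0)
    then show "(\<lambda>k. M * (t - s + h k)) \<longlonglongrightarrow> M * (t - s)" by simp
    show "\<exists>N. \<forall>k\<ge>N. norm (step_path p (h k) t - step_path p (h k) s) \<le> M * (t - s + h k)"
      using step_path_lipschitz[OF p h that] by blast
  qed
  have lip: "norm (u s - u t) \<le> M * \<bar>s - t\<bar>" if "0 \<le> s" "0 \<le> t" for s t
    using lip_le[of s t] lip_le[of t s] that by (cases "s \<le> t") (auto simp: norm_minus_commute)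
  have cont: "continuous_on {0..} u"
    by (rule lipschitz_on_continuous_on[where L = M])
      (use lip M in \<open>auto intro!: lipschitz_onI simp: dist_norm\<close>)
  have "integral_solution C p u"
    unfolding integral_solution_def
  proof (intro conjI allI impI ballI)
    show "continuous_on {0..} u" by fact
    have "(\<lambda>k. step_path p (h k) 0) \<longlonglongrightarrow> p" by (simp add: step_path_def)
    then show "u 0 = p" using lim[of 0] LIMSEQ_unique by blast
  next
    fix s t :: real and z y
    assume st: "0 \<le> s \<and> s < t" and y: "y \<in> C z"
    define f where "f \<tau> = j (z - u \<tau>) y" for \<tau>
    define G where "G t = integral {0..t} f" for t
    have fint: "f integrable_on {a..b}" if "0 \<le> a" for a b
      unfolding f_def using that by (intro integrable_continuous_interval continuous_on_j continuous_intros
        continuous_on_subset[OF cont]) auto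
    have Gcont: "continuous_on {0..t} G"
      unfolding G_def by (intro indefinite_integral_continuous_1 fint) simp
    \<comment> \<open>The discrete inequality is available at grid times only; continuity of
      \<open>G\<close> removes the rounding in the limit.\<close>
    define grid where "grid k a = real (nat \<lfloor>a / h k\<rfloor>) * h k" for k a
    have grid: "a - h k \<le> grid k a" "grid k a \<le> a" "0 \<le> grid k a" if "0 \<le> a" for k a
      using nat_floor_div_bounds[OF that h(1)[of k]] h(1)[of k] by (auto simp: grid_def)
    have grid_lim: "(\<lambda>k. grid k a) \<longlonglongrightarrow> a" if "0 \<le> a" for a
    proof (rule tendsto_sandwich)
      show "(\<lambda>k. a - h k) \<longlonglongrightarrow> a" using tendsto_diff[OF tendsto_const h0, of a] by simp
    qed (use grid[OF that] in auto)
    have Glim: "(\<lambda>k. G (grid k a)) \<longlonglongrightarrow> G a" if "0 \<le> a" "a \<le> t" for a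
    proof (rule continuous_on_tendsto_compose[OF Gcont grid_lim])
      show "eventually (\<lambda>k. grid k a \<in> {0..t}) sequentially"
        using grid(2,3)[OF that(1)] that by (intro always_eventually) (auto intro: order_trans)
    qed (use that in auto)
    define err where "err k = 2 * (K * (R t * \<rho> ^ k / (1 - \<rho>) + M * h k) * norm y)
        + 2 * (norm (p - z) + t * M) * (h k * M / \<theta>)" for k
    have err0: "err \<longlonglongrightarrow> 0"
    proof -
      have "(\<lambda>k. \<rho> ^ k) \<longlonglongrightarrow> 0" using \<rho> by (rule LIMSEQ_realpow_zero)
      then have "err \<longlonglongrightarrow> 2 * (K * (R t * 0 / (1 - \<rho>) + M * 0) * norm y)
        + 2 * (norm (p - z) + t * M) * (0 * M / \<theta>)"
        unfolding err_def using \<rho> \<theta>_pos by (intro tendsto_intros h0) auto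
      then show ?thesis by simp
    qed
    have ineq: "(norm (step_path p (h k) t - z))\<^sup>2 - (norm (step_path p (h k) s - z))\<^sup>2
        \<le> 2 * (G (grid k t) - G (grid k s)) + t * \<bar>err k\<bar>" for k
    proof -
      define m where "m = nat \<lfloor>s / h k\<rfloor>"
      define n where "n = nat \<lfloor>t / h k\<rfloor>"
      have mn: "m \<le> n"
        unfolding m_def n_def using st h(1)[of k] by (intro nat_mono floor_mono divide_right_mono) auto
      have nt: "real n * h k \<le> t"
        using grid(2)[of t k] st by (simp add: grid_def n_def)
      have near: "norm (step_path p (h k) \<tau> - u \<tau>) \<le> R t * \<rho> ^ k / (1 - \<rho>)" if "0 \<le> \<tau>" "\<tau> \<le> t" for \<tau>
        using rate[OF that] .
      have "real (n - m) * (h k * err k) \<le> (real (n - m) * h k) * \<bar>err k\<bar>"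
        using h(1)[of k] by (auto simp: mult.assoc intro!: mult_left_mono)
      also have "\<dots> \<le> t * \<bar>err k\<bar>"
      proof (rule mult_right_mono)
        have "real (n - m) * h k \<le> real n * h k"
          using h(1)[of k] by (intro mult_right_mono) auto
        then show "real (n - m) * h k \<le> t" using nt by simp
      qed simp
      finally show ?thesis
        using step_path_integral_estimate[OF p h[of k] lip near y mn nt]
        by (simp add: step_path_def m_def n_def grid_def err_def G_def f_def[abs_def])
    qed
    have "(norm (u t - z))\<^sup>2 - (norm (u s - z))\<^sup>2 \<le> 2 * (G t - G s) + t * \<bar>0\<bar>"
    proof (rule LIMSEQ_le)
      show "(\<lambda>k. (norm (step_path p (h k) t - z))\<^sup>2 - (norm (step_path p (h k) s - z))\<^sup>2)
          \<longlonglongrightarrow> (norm (u t - z))\<^sup>2 - (norm (u s - z))\<^sup>2"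
        using st by (intro tendsto_intros lim) auto
      show "(\<lambda>k. 2 * (G (grid k t) - G (grid k s)) + t * \<bar>err k\<bar>) \<longlonglongrightarrow> 2 * (G t - G s) + t * \<bar>0\<bar>"
        using st by (intro tendsto_intros Glim err0) auto
    qed (use ineq in blast)
    moreover have "G s + integral {s..t} f = G t"
      unfolding G_def using st fint by (intro Henstock_Kurzweil_Integration.integral_combine) auto
    ultimately show "(norm (u t - z))\<^sup>2 - (norm (u s - z))\<^sup>2 \<le> 2 * integral {s..t} (\<lambda>\<tau>. j (z - u \<tau>) y)"
      by (simp add: f_def[abs_def])
  qed
  then show ?thesis by blast
qed

end

section \<open>Almost-orbits\<close>

lemma step_sum_eq: "step_sum lam n = (\<Sum>i<n. lam (Suc i))"
  by (simp add: step_sum_def sum.atLeast1_atMost_eq)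

lemma step_sum_mono:
  assumes "\<And>n. n \<ge> 1 \<Longrightarrow> lam n > 0" "m \<le> n"
  shows "step_sum lam m \<le> step_sum lam n"
  unfolding step_sum_def using assms by (intro sum_mono2) (auto intro: less_imp_le)

lemma step_sum_unbounded:
  assumes pos: "\<And>n. n \<ge> 1 \<Longrightarrow> lam n > 0" and div: "\<not> summable (\<lambda>n. lam (Suc n))"
  shows "\<exists>N. t < step_sum lam N"
proof (rule ccontr)
  assume "\<not> ?thesis"
  then have "(\<Sum>i<n. lam (Suc i)) \<le> t" for n
    by (auto simp: step_sum_eq not_less)
  then have "summable (\<lambda>n. lam (Suc n))"
    using pos by (intro summableI_nonneg_bounded) (auto intro: less_imp_le)
  with div show False ..
qed

text \<open>Divergence of the step sums makes the set under \<open>Max\<close> finite, and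
  \<open>t \<ge> 0\<close> puts 0 into it; only then does \<open>step_index\<close> select an
  element.\<close>

lemma step_index_bounds:
  assumes pos: "\<And>n. n \<ge> 1 \<Longrightarrow> lam n > 0" and div: "\<not> summable (\<lambda>n. lam (Suc n))" and t: "t \<ge> 0"
  shows "step_sum lam (step_index lam t) \<le> t" "t < step_sum lam (Suc (step_index lam t))"
    "step_sum lam n \<le> t \<Longrightarrow> n \<le> step_index lam t"
proof -
  define S where "S = {n. step_sum lam n \<le> t}"
  obtain N where N: "t < step_sum lam N" using step_sum_unbounded[OF pos div] by blast
  have "n < N" if "n \<in> S" for n
    using step_sum_mono[of lam N n] pos N that by (force simp: S_def not_less[symmetric])
  then have fin: "finite S" using finite_subset[of S "{..<N}"] by auto
  have "0 \<in> S" using t by (simp add: S_def step_sum_def)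
  then have "Max S \<in> S" using fin by (intro Max_in) auto
  then show "step_sum lam (step_index lam t) \<le> t" by (simp add: step_index_def S_def)
  show le: "n \<le> step_index lam t" if "step_sum lam n \<le> t" for n
    unfolding step_index_def using fin that by (intro Max_ge) (auto simp: S_def)
  show "t < step_sum lam (Suc (step_index lam t))"
    using le[of "Suc (step_index lam t)"] by (auto simp: not_le[symmetric])
qed

lemma fb_compose_same: "fb_compose A B lam m m p = p"
  by (simp add: fb_compose_def)

lemma fb_compose_Suc:
  "m \<le> n \<Longrightarrow> fb_compose A B lam m (Suc n) p = fb_step A B (lam (Suc n)) (fb_compose A B lam m n p)"
  by (simp add: fb_compose_def)

lemma fb_compose_trans:
  assumes "l \<le> m" "m \<le> n"
  shows "fb_compose A B lam m n (fb_compose A B lam l m p) = fb_compose A B lam l n p"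
  using assms(2) by (induction n rule: dec_induct)
    (use assms(1) in \<open>simp_all add: fb_compose_same fb_compose_Suc\<close>)

lemma almost_orbitI:
  assumes "\<And>\<epsilon>. \<epsilon> > 0 \<Longrightarrow>
    eventually (\<lambda>t. \<forall>h\<ge>0. norm (\<phi> (t + h) - U (t + h) t (\<phi> t)) \<le> \<epsilon>) at_top"
  shows "almost_orbit U \<phi>"
  unfolding almost_orbit_def
proof (rule order_tendstoI)
  fix a :: ereal assume a: "a < 0"
  have "a < (SUP h\<in>{0..}. ereal (norm (\<phi> (t + h) - U (t + h) t (\<phi> t))))" for t
    using a by (intro less_le_trans[OF _ SUP_upper2[of 0]]) auto
  then show "eventually (\<lambda>t. a < (SUP h\<in>{0..}. ereal (norm (\<phi> (t + h) - U (t + h) t (\<phi> t))))) at_top"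
    by simp
next
  fix a :: ereal assume "0 < a"
  then obtain e where e: "0 < ereal e" "ereal e < a"
    using ereal_dense2 by blast
  then have "eventually (\<lambda>t. \<forall>h\<ge>0. norm (\<phi> (t + h) - U (t + h) t (\<phi> t)) \<le> e) at_top"
    by (intro assms) simp
  then show "eventually (\<lambda>t. (SUP h\<in>{0..}. ereal (norm (\<phi> (t + h) - U (t + h) t (\<phi> t)))) < a) at_top"
  proof eventually_elim
    case (elim t)
    then have "(SUP h\<in>{0..}. ereal (norm (\<phi> (t + h) - U (t + h) t (\<phi> t)))) \<le> ereal e"
      by (intro SUP_least) auto
    then show ?case using e(2) by simp
  qed
qed

text \<open>One threshold for both the steps and all partial sums of their squares, so that a single
  parameter controls every error after index \<open>m\<close>.\<close>

definition small_tail :: "(nat \<Rightarrow> real) \<Rightarrow> real \<Rightarrow> nat \<Rightarrow> bool" where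
  "small_tail lam \<delta> m \<longleftrightarrow> (\<forall>i>m. lam i \<le> \<delta>) \<and> (\<forall>n. (\<Sum>i<n. (lam (Suc (m + i)))\<^sup>2) \<le> \<delta>)"

lemma small_tail_eventually:
  assumes pos: "\<And>n. n \<ge> 1 \<Longrightarrow> lam n > 0" and sq: "summable (\<lambda>n. (lam (Suc n))\<^sup>2)" and \<delta>: "\<delta> > 0"
  shows "eventually (small_tail lam \<delta>) sequentially"
proof -
  have "(\<lambda>n. (lam (Suc n))\<^sup>2) \<longlonglongrightarrow> 0" using sq by (rule summable_LIMSEQ_zero)
  then have "eventually (\<lambda>n. (lam (Suc n))\<^sup>2 < \<delta>\<^sup>2) sequentially"
    by (rule order_tendstoD) (use \<delta> in simp)
  then obtain N1 where N1: "\<And>n. n \<ge> N1 \<Longrightarrow> (lam (Suc n))\<^sup>2 < \<delta>\<^sup>2"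
    by (auto simp: eventually_sequentially)
  obtain N2 where N2: "\<And>n. n \<ge> N2 \<Longrightarrow> norm (\<Sum>i. (lam (Suc (i + n)))\<^sup>2) < \<delta>"
    using suminf_exist_split[OF \<delta> sq] by auto
  have "small_tail lam \<delta> m" if m: "m \<ge> max N1 N2" for m
    unfolding small_tail_def
  proof (intro conjI allI impI)
    fix i assume "m < i"
    then obtain n where n: "i = Suc n" "n \<ge> N1" using m by (cases i) auto
    then have "(lam i)\<^sup>2 \<le> \<delta>\<^sup>2" using N1[of n] by simp
    then show "lam i \<le> \<delta>"
      by (rule power2_le_imp_le) (use \<delta> in simp)
  next
    fix n
    have "(\<Sum>i<n. (lam (Suc (i + m)))\<^sup>2) \<le> (\<Sum>i. (lam (Suc (i + m)))\<^sup>2)"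
      using summable_ignore_initial_segment[OF sq, of m] by (intro sum_le_suminf) auto
    also have "\<dots> \<le> \<delta>" using N2[of m] m by simp
    finally show "(\<Sum>i<n. (lam (Suc (m + i)))\<^sup>2) \<le> \<delta>" by (simp add: add.commute)
  qed
  then show ?thesis unfolding eventually_sequentially by blast
qed

section \<open>General initial points and the uniform tail estimate\<close>

context forward_backward
begin

text \<open>Uniform closeness preserves continuity and changes the integral by at most
  \<open>(t - s) * (K * \<delta> k * norm y)\<close>.\<close>

lemma integral_solution_limit:
  assumes u: "\<And>k::nat. integral_solution C (p k) (u k)"
    and near: "\<And>k t. t \<ge> 0 \<Longrightarrow> norm (u k t - v t) \<le> \<delta> k" and \<delta>: "\<delta> \<longlonglongrightarrow> 0"
  shows "integral_solution C (v 0) v"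
  unfolding integral_solution_def
proof (intro conjI allI impI ballI)
  have uc: "continuous_on {0..} (u k)" for k using u by (simp add: integral_solution_def)
  have "uniform_limit {0..} u v sequentially"
    unfolding uniform_limit_iff
  proof (intro allI impI)
    fix e :: real assume "e > 0"
    then have "eventually (\<lambda>k. \<delta> k < e) sequentially" using order_tendstoD(2)[OF \<delta>] by simp
    then show "eventually (\<lambda>k. \<forall>t\<in>{0..}. dist (u k t) (v t) < e) sequentially"
      by eventually_elim (use near in \<open>auto simp: dist_norm intro: le_less_trans\<close>)
  qed
  then show cont: "continuous_on {0..} v"
    using uc by (intro uniform_limit_theorem[where f = u and F = sequentially]) auto
  have lim: "(\<lambda>k. u k t) \<longlonglongrightarrow> v t" if "t \<ge> 0" for t
    by (rule LIM_zero_cancel, rule Lim_null_comparison[OF _ \<delta>]) (use near[OF that] in simp)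
  fix s t :: real and z y
  assume st: "0 \<le> s \<and> s < t" and y: "y \<in> C z" "z \<in> op_domain C"
  have int: "(\<lambda>\<tau>. j (z - w \<tau>) y) integrable_on {s..t}" if "continuous_on {0..} w" for w
    using st by (intro integrable_continuous_interval continuous_on_j continuous_intros
        continuous_on_subset[OF that]) auto
  define I where "I = integral {s..t} (\<lambda>\<tau>. j (z - v \<tau>) y)"
  have "(norm (v t - z))\<^sup>2 - (norm (v s - z))\<^sup>2 \<le> 2 * (I + (t - s) * (K * 0 * norm y))"
  proof (rule LIMSEQ_le)
    show "(\<lambda>k. (norm (u k t - z))\<^sup>2 - (norm (u k s - z))\<^sup>2) \<longlonglongrightarrow> (norm (v t - z))\<^sup>2 - (norm (v s - z))\<^sup>2"
      using st by (intro tendsto_intros lim) auto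
    show "(\<lambda>k. 2 * (I + (t - s) * (K * \<delta> k * norm y))) \<longlonglongrightarrow> 2 * (I + (t - s) * (K * 0 * norm y))"
      by (intro tendsto_intros \<delta>)
    have "(norm (u k t - z))\<^sup>2 - (norm (u k s - z))\<^sup>2 \<le> 2 * (I + (t - s) * (K * \<delta> k * norm y))" for k
    proof -
      have "(norm (u k t - z))\<^sup>2 - (norm (u k s - z))\<^sup>2 \<le> 2 * integral {s..t} (\<lambda>\<tau>. j (z - u k \<tau>) y)"
        using u[of k] st y by (simp add: integral_solution_def)
      also have "integral {s..t} (\<lambda>\<tau>. j (z - u k \<tau>) y)
          \<le> integral {s..t} (\<lambda>\<tau>. j (z - v \<tau>) y + K * \<delta> k * norm y)"
      proof (rule integral_le)
        show "(\<lambda>\<tau>. j (z - v \<tau>) y + K * \<delta> k * norm y) integrable_on {s..t}"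
          by (intro integrable_add int cont) auto
        fix \<tau> assume "\<tau> \<in> {s..t}"
        then have "norm (u k \<tau> - v \<tau>) \<le> \<delta> k" using st by (intro near) auto
        then have "K * norm (u k \<tau> - v \<tau>) * norm y \<le> K * \<delta> k * norm y"
          using K_pos by (intro mult_right_mono mult_left_mono) auto
        then show "j (z - u k \<tau>) y \<le> j (z - v \<tau>) y + K * \<delta> k * norm y"
          using j_lip[of "z - u k \<tau>" y "z - v \<tau>"] by (simp add: norm_minus_commute)
      qed (intro int uc)
      also have "\<dots> = I + (t - s) * (K * \<delta> k * norm y)"
        using st by (subst integral_add) (auto simp: I_def intro: int cont)
      finally show ?thesis by simp
    qed
    then show "\<exists>N. \<forall>k\<ge>N. (norm (u k t - z))\<^sup>2 - (norm (u k s - z))\<^sup>2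
        \<le> 2 * (I + (t - s) * (K * \<delta> k * norm y))" by blast
  qed
  then show "(norm (v t - z))\<^sup>2 - (norm (v s - z))\<^sup>2 \<le> 2 * integral {s..t} (\<lambda>\<tau>. j (z - v \<tau>) y)"
    by (simp add: I_def)
qed simp

text \<open>Contraction turns convergence of the initial points into convergence of the solutions,
  uniform over all times.\<close>

lemma integral_solution_exists:
  assumes x: "x \<in> closure (op_domain A)"
  shows "\<exists>u. integral_solution C x u"
proof -
  obtain p where p: "\<And>k. p k \<in> op_domain A" "p \<longlonglongrightarrow> x"
    using x closure_sequential by blast
  have pc: "p k \<in> closure (op_domain A)" for k using p(1) closure_subset by blast
  have "\<exists>u. integral_solution C (p k) u" for k
    using domain_slow[OF p(1)] integral_solution_exists_slow by blast
  then obtain u where u: "\<And>k. integral_solution C (p k) (u k)" by metis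
  define v where "v t = lim (\<lambda>k. u k t)" for t
  have lim: "(\<lambda>k. u k t) \<longlonglongrightarrow> v t" if t: "t \<ge> 0" for t
  proof -
    have "Cauchy (\<lambda>k. u k t)"
    proof (rule metric_CauchyI)
      fix e :: real assume "e > 0"
      then obtain N where "\<forall>m\<ge>N. \<forall>n\<ge>N. dist (p m) (p n) < e"
        using LIMSEQ_imp_Cauchy[OF p(2)] metric_CauchyD by blast
      then show "\<exists>N. \<forall>m\<ge>N. \<forall>n\<ge>N. dist (u m t) (u n t) < e"
        using integral_solution_contraction[OF u u pc pc t] unfolding dist_norm
        by (meson le_less_trans)
    qed
    then show ?thesis unfolding v_def using Cauchy_convergent convergent_LIMSEQ_iff by blast
  qed
  have near: "norm (u k t - v t) \<le> norm (p k - x)" if t: "t \<ge> 0" for k t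
  proof (rule LIMSEQ_le)
    show "(\<lambda>l. norm (u k t - u l t)) \<longlonglongrightarrow> norm (u k t - v t)"
      by (intro tendsto_intros lim t)
    show "(\<lambda>l. norm (p k - p l)) \<longlonglongrightarrow> norm (p k - x)"
      by (intro tendsto_intros p)
  qed (use integral_solution_contraction[OF u u pc pc t] in blast)
  have "(\<lambda>k. norm (p k - x)) \<longlonglongrightarrow> 0"
    using p(2) by (simp add: LIM_zero tendsto_norm_zero)
  with u near have "integral_solution C (v 0) v" by (rule integral_solution_limit)
  moreover have "v 0 = x"
    using lim[of 0] p(2) u LIMSEQ_unique by (simp add: integral_solution_def) blast
  ultimately show ?thesis by blast
qed

lemma semigroup_of_eq:
  assumes u: "integral_solution C x u" and x: "x \<in> closure (op_domain A)" and t: "t \<ge> 0"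
  shows "semigroup_of C t x = u t"
  unfolding semigroup_of_def
proof (rule the_equality)
  show "\<exists>u'. integral_solution C x u' \<and> u' t = u t" using u by blast
next
  fix v assume "\<exists>u'. integral_solution C x u' \<and> u' t = v"
  then show "v = u t"
    using integral_solution_contraction[OF _ u x x t] by fastforce
qed

text \<open>The square root is the Gronwall bound for an initial error \<open>\<delta>\<close> and
  squared steps of sum at most \<open>\<delta>\<close>; \<open>M * \<delta>\<close> pays for a time
  mismatch of \<open>\<delta>\<close>. The extra \<open>\<delta>\<close> is a reserve for the
  distance of a solution from a slow point.\<close>

definition tail_error :: "real \<Rightarrow> real \<Rightarrow> real" where
  "tail_error M \<delta> = (M + 1) * \<delta> + sqrt (exp \<delta> * (\<delta>\<^sup>2 + \<delta> * (2 * (K * M * M) + step_const M)))"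

lemma tail_error_small:
  assumes "\<epsilon> > 0"
  obtains \<delta> where "\<delta> > 0" "K * \<delta> \<le> \<theta>" "tail_error M \<delta> \<le> \<epsilon>"
proof -
  have "(tail_error M \<longlongrightarrow> (M + 1) * 0 + sqrt (exp 0 * (0\<^sup>2 + 0 * (2 * (K * M * M) + step_const M)))) (at_right 0)"
    unfolding tail_error_def by (intro tendsto_intros)
  then have "eventually (\<lambda>\<delta>. tail_error M \<delta> < \<epsilon>) (at_right 0)"
    using assms by (intro order_tendstoD) auto
  moreover have "eventually (\<lambda>\<delta>. \<delta> < \<theta> / K) (at_right 0)"
    using \<theta>_pos K_pos by (intro eventually_at_rightI[of 0 "\<theta> / K"]) auto
  moreover have "eventually (\<lambda>\<delta>::real. \<delta> > 0) (at_right 0)"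
    by (rule eventually_at_right_less)
  ultimately have "eventually (\<lambda>\<delta>. \<delta> > 0 \<and> K * \<delta> \<le> \<theta> \<and> tail_error M \<delta> \<le> \<epsilon>) (at_right 0)"
    by eventually_elim (use K_pos in \<open>auto simp: field_simps\<close>)
  then show thesis
    using that eventually_happens' trivial_limit_at_right_real by blast
qed

lemma fb_compose_nonexpansive:
  assumes "m \<le> n" "\<And>i. m < i \<Longrightarrow> lam i > 0" "\<And>i. m < i \<Longrightarrow> K * lam i \<le> \<theta>"
  shows "norm (fb_compose A B lam m n p - fb_compose A B lam m n q) \<le> norm (p - q)"
  using assms(1)
proof (induction n rule: dec_induct)
  case (step k)
  have "norm (T (lam (Suc k)) (fb_compose A B lam m k p) - T (lam (Suc k)) (fb_compose A B lam m k q))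
      \<le> norm (fb_compose A B lam m k p - fb_compose A B lam m k q)"
    using step.hyps by (intro fb_step_nonexpansive assms) auto
  then show ?case
    using step by (simp add: fb_compose_Suc)
qed (simp add: fb_compose_same)

lemma fb_compose_slow:
  assumes "m \<le> n" "\<And>i. m < i \<Longrightarrow> lam i > 0" "\<And>i. m < i \<Longrightarrow> K * lam i \<le> \<theta>" "p \<in> slow M"
  shows "fb_compose A B lam m n p \<in> slow M"
  using assms(1)
proof (induction n rule: dec_induct)
  case (step n)
  then show ?case
    using fb_step_slow(1)[OF _ assms(2,3), of _ M "Suc n"] by (simp add: fb_compose_Suc)
qed (simp add: fb_compose_same assms)

text \<open>For an \<open>M\<close>-Lipschitz solution the oscillation over a step is
  \<open>M * r\<close>, so growth and source terms are both multiples of \<open>r\<^sup>2\<close>.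
  Their sums are at most multiples of \<open>\<delta>\<close> for every \<open>n\<close>, which
  gives uniformity in time.\<close>

lemma fb_compose_tail:
  assumes v: "integral_solution C x v"
    and lip: "\<And>s t. s \<ge> 0 \<Longrightarrow> t \<ge> 0 \<Longrightarrow> norm (v s - v t) \<le> M * \<bar>s - t\<bar>"
    and p: "p \<in> slow M" and px: "norm (x - p) \<le> \<delta>"
    and pos: "\<And>n. n \<ge> 1 \<Longrightarrow> lam n > 0"
    and tail: "small_tail lam \<delta> m" and \<delta>: "\<delta> > 0" "K * \<delta> \<le> \<theta>" and mn: "m \<le> n"
    and h: "h \<ge> 0" "\<bar>step_sum lam n - step_sum lam m - h\<bar> \<le> \<delta>"
  shows "norm (v h - fb_compose A B lam m n p) \<le> tail_error M \<delta> - \<delta>"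
proof -
  have M: "M \<ge> 0" using p by (rule slow_nonneg)
  have lam: "lam i > 0" "K * lam i \<le> \<theta>" if "m < i" for i
  proof -
    show "lam i > 0" using that pos by simp
    have "K * lam i \<le> K * \<delta>"
      using tail that K_pos unfolding small_tail_def by (intro mult_left_mono) auto
    then show "K * lam i \<le> \<theta>" using \<delta> by simp
  qed
  define \<sigma> where "\<sigma> i = step_sum lam (m + i) - step_sum lam m" for i
  define y where "y i = fb_compose A B lam m (m + i) p" for i
  define a where "a i = (norm (v (\<sigma> i) - y i))\<^sup>2" for i
  define \<alpha> where "\<alpha> i = (lam (Suc (m + i)))\<^sup>2" for i
  define c where "c = 2 * (K * M * M) + step_const M"
  have c: "c \<ge> 0" using K_pos M step_const_nonneg by (simp add: c_def)
  have \<sigma>0: "\<sigma> i \<ge> 0" for i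
    using step_sum_mono[of lam m "m + i"] pos by (simp add: \<sigma>_def)
  have "a (n - m) \<le> exp (\<Sum>i<n - m. \<alpha> i) * (a 0 + (\<Sum>i<n - m. \<alpha> i * c))"
  proof (rule discrete_gronwall)
    fix i
    define r where "r = lam (Suc (m + i))"
    have r: "r > 0" "K * r \<le> \<theta>" using lam by (auto simp: r_def)
    have y: "y i \<in> slow M" unfolding y_def by (rule fb_compose_slow) (use lam p in auto)
    have "norm (v \<tau> - v (\<sigma> i)) \<le> M * r" if "\<sigma> i \<le> \<tau>" "\<tau> \<le> \<sigma> i + r" for \<tau>
    proof -
      have "norm (v \<tau> - v (\<sigma> i)) \<le> M * \<bar>\<tau> - \<sigma> i\<bar>"
        using \<sigma>0[of i] that by (intro lip) auto
      also have "\<dots> \<le> M * r" using that M by (intro mult_left_mono) auto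
      finally show ?thesis .
    qed
    from integral_solution_step[OF v \<sigma>0 y r this]
    have "(norm (v (\<sigma> i + r) - T r (y i)))\<^sup>2 \<le> (1 + r\<^sup>2) * a i + r\<^sup>2 * c"
      by (simp add: a_def c_def power2_eq_square algebra_simps)
    moreover have "\<sigma> i + r = \<sigma> (Suc i)" by (simp add: \<sigma>_def r_def step_sum_eq)
    moreover have "T r (y i) = y (Suc i)" by (simp add: y_def r_def fb_compose_Suc)
    ultimately show "a (Suc i) \<le> (1 + \<alpha> i) * a i + \<alpha> i * c" by (simp add: a_def \<alpha>_def r_def)
  qed (use c in \<open>auto simp: a_def \<alpha>_def\<close>)
  also have "\<dots> \<le> exp \<delta> * (\<delta>\<^sup>2 + \<delta> * c)"
  proof (intro mult_mono add_mono)
    have \<alpha>: "(\<Sum>i<n - m. \<alpha> i) \<le> \<delta>" using tail by (simp add: small_tail_def \<alpha>_def)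
    then show "exp (\<Sum>i<n - m. \<alpha> i) \<le> exp \<delta>" by simp
    show "(\<Sum>i<n - m. \<alpha> i * c) \<le> \<delta> * c"
      using mult_right_mono[OF \<alpha> c] by (simp add: sum_distrib_right)
    have "v 0 = x" using v by (simp add: integral_solution_def)
    then have "a 0 = (norm (x - p))\<^sup>2" by (simp add: a_def \<sigma>_def y_def fb_compose_same)
    also have "\<dots> \<le> \<delta>\<^sup>2" using px by (rule power_mono) simp
    finally show "a 0 \<le> \<delta>\<^sup>2" .
    show "0 \<le> a 0 + (\<Sum>i<n - m. \<alpha> i * c)"
      using c by (intro add_nonneg_nonneg sum_nonneg) (auto simp: a_def \<alpha>_def)
  qed simp
  finally have "norm (v (\<sigma> (n - m)) - y (n - m)) \<le> sqrt (exp \<delta> * (\<delta>\<^sup>2 + \<delta> * c))"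
    unfolding a_def by (rule real_le_rsqrt)
  moreover have "norm (v h - v (\<sigma> (n - m))) \<le> M * \<delta>"
  proof -
    have "norm (v h - v (\<sigma> (n - m))) \<le> M * \<bar>h - \<sigma> (n - m)\<bar>"
      using h \<sigma>0 by (intro lip) auto
    also have "\<dots> \<le> M * \<delta>"
      using h(2) mn M by (intro mult_left_mono) (auto simp: \<sigma>_def abs_minus_commute)
    finally show ?thesis .
  qed
  moreover have "tail_error M \<delta> - \<delta> = M * \<delta> + sqrt (exp \<delta> * (\<delta>\<^sup>2 + \<delta> * c))"
    unfolding tail_error_def c_def by (simp add: distrib_right)
  moreover have "y (n - m) = fb_compose A B lam m n p"
    using mn by (simp add: y_def)
  ultimately show ?thesis
    using norm_triangle_ineq[of "v h - v (\<sigma> (n - m))" "v (\<sigma> (n - m)) - y (n - m)"] by simp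
qed

section \<open>Square-summable, non-summable steps and the two almost-orbits\<close>

context
  fixes lam :: "nat \<Rightarrow> real"
  assumes pos: "\<And>n. n \<ge> 1 \<Longrightarrow> lam n > 0"
    and sq: "summable (\<lambda>n. (lam (Suc n))\<^sup>2)"
    and div: "\<not> summable (\<lambda>n. lam (Suc n))"
begin

lemma step_index_mono:
  assumes "0 \<le> s" "s \<le> t"
  shows "step_index lam s \<le> step_index lam t"
proof (rule step_index_bounds(3)[where lam = lam, OF pos div])
  have "step_sum lam (step_index lam s) \<le> s"
    by (rule step_index_bounds(1)[where lam = lam, OF pos div assms(1)])
  also note assms(2)
  finally show "step_sum lam (step_index lam s) \<le> t" .
  show "0 \<le> t" using assms by linarith
qed

text \<open>Rounding down at \<open>t\<close> and at \<open>t + h\<close> each errs by an amount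
  between 0 and \<open>\<delta>\<close>; the difference of the two is again at most
  \<open>\<delta>\<close>.\<close>

lemma step_index_gap:
  assumes "small_tail lam \<delta> (step_index lam t)" "t \<ge> 0" "h \<ge> 0"
  shows "\<bar>step_sum lam (step_index lam (t + h)) - step_sum lam (step_index lam t) - h\<bar> \<le> \<delta>"
proof -
  define m where "m = step_index lam t"
  define n where "n = step_index lam (t + h)"
  have mn: "m \<le> n" unfolding m_def n_def using assms by (intro step_index_mono) auto
  have "step_sum lam m \<le> t" "t < step_sum lam m + lam (Suc m)"
      "step_sum lam n \<le> t + h" "t + h < step_sum lam n + lam (Suc n)"
    using step_index_bounds(1,2)[where lam = lam, OF pos div, of t] step_index_bounds(1,2)[where lam = lam, OF pos div, of "t + h"] assms
    by (simp_all add: m_def n_def step_sum_eq)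
  moreover have "lam (Suc m) \<le> \<delta>" "lam (Suc n) \<le> \<delta>"
    using assms(1) mn by (auto simp: small_tail_def m_def)
  ultimately show ?thesis by (simp add: m_def n_def abs_le_iff)
qed

lemma eventually_step_index:
  assumes "eventually P sequentially"
  shows "eventually (\<lambda>t. t \<ge> 0 \<and> P (step_index lam t)) at_top"
proof -
  obtain N where N: "\<And>n. n \<ge> N \<Longrightarrow> P n" using assms by (auto simp: eventually_sequentially)
  show ?thesis
    using eventually_ge_at_top[of 0] eventually_ge_at_top[of "step_sum lam N"]
  proof eventually_elim
    case (elim t)
    then show ?case using step_index_bounds(3)[where lam = lam, OF pos div elim(1) elim(2)] N by blast
  qed
qed

text \<open>The point \<open>x\<close> is replaced by a slow \<open>x0\<close>, and
  \<open>v0 t\<close> by a slow \<open>q\<close> with the same \<open>M\<close>. That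
  \<open>M\<close> does not depend on \<open>t\<close> is essential, since \<open>\<delta>\<close>
  is fixed before \<open>t\<close> grows.\<close>

lemma semigroup_almost_orbit:
  assumes x: "x \<in> closure (op_domain A)"
  shows "almost_orbit (discrete_evolution A B lam) (\<lambda>t. semigroup_of C t x)"
proof (rule almost_orbitI)
  fix e :: real assume e: "e > 0"
  \<comment> \<open>Replacing \<open>v\<close> by \<open>v0\<close> costs \<open>\<epsilon>\<close>
    at time \<open>t + h\<close> and again at time \<open>t\<close>; the tail estimate, with the
    reserve \<open>\<delta>\<close> spent on \<open>q\<close>, costs the third.\<close>
  define \<epsilon> where "\<epsilon> = e / 3"
  have \<epsilon>: "\<epsilon> > 0" using e by (simp add: \<epsilon>_def)
  obtain x0 M where x0: "x0 \<in> slow M" "norm (x - x0) < \<epsilon>"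
    using closure_domainE[OF x \<epsilon>] .
  have x0c: "x0 \<in> closure (op_domain A)"
    using x0(1) slow_subset_domain closure_subset by blast
  obtain v where v: "integral_solution C x v" using integral_solution_exists[OF x] by blast
  obtain v0 where v0: "integral_solution C x0 v0" using integral_solution_exists[OF x0c] by blast
  obtain \<delta> where \<delta>: "\<delta> > 0" "K * \<delta> \<le> \<theta>" "tail_error M \<delta> \<le> \<epsilon>"
    using tail_error_small[OF \<epsilon>] .
  have "eventually (small_tail lam \<delta>) sequentially"
    by (rule small_tail_eventually[where lam = lam, OF pos sq \<delta>(1)])
  from eventually_step_index[OF this]
  show "eventually (\<lambda>t. \<forall>h\<ge>0. norm (semigroup_of C (t + h) x
      - discrete_evolution A B lam (t + h) t (semigroup_of C t x)) \<le> e) at_top"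
  proof eventually_elim
    case (elim t)
    show ?case
    proof (intro allI impI)
      fix h :: real assume h: "h \<ge> 0"
      define m where "m = step_index lam t"
      define n where "n = step_index lam (t + h)"
      define Y where "Y = fb_compose A B lam m n"
      have t: "t \<ge> 0" and tail: "small_tail lam \<delta> m" using elim by (auto simp: m_def)
      have mn: "m \<le> n" unfolding m_def n_def using t h by (intro step_index_mono) auto
      obtain q where q: "q \<in> slow M" "norm (v0 t - q) \<le> \<delta>"
        using integral_solution_near_slow[OF v0 t x0(1) \<delta>(1)] by auto
      have 1: "norm (v0 (t + h) - Y q) \<le> tail_error M \<delta> - \<delta>"
        unfolding Y_def
      proof (rule fb_compose_tail[where lam = lam, OF integral_solution_shift[OF v0 t] _ q pos tail \<delta>(1,2) mn h])
        fix s s' :: real assume "s \<ge> 0" "s' \<ge> 0"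
        then show "norm (v0 (t + s) - v0 (t + s')) \<le> M * \<bar>s - s'\<bar>"
          using integral_solution_lipschitz[OF v0 x0(1), of "t + s" "t + s'"] t by simp
      next
        show "\<bar>step_sum lam n - step_sum lam m - h\<bar> \<le> \<delta>"
          using step_index_gap[OF tail[unfolded m_def] t h] by (simp add: m_def n_def)
      qed
      have contr: "norm (v s - v0 s) \<le> \<epsilon>" if "s \<ge> 0" for s
        using integral_solution_contraction[OF v v0 x x0c that] x0(2) by simp
      have 2: "norm (Y q - Y (v t)) \<le> norm (q - v t)"
        unfolding Y_def
      proof (rule fb_compose_nonexpansive[OF mn])
        fix i assume i: "m < i"
        then show "lam i > 0" using pos by simp
        have "K * lam i \<le> K * \<delta>"
          using tail i K_pos unfolding small_tail_def by (intro mult_left_mono) auto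
        then show "K * lam i \<le> \<theta>" using \<delta> by simp
      qed
      have 3: "norm (q - v t) \<le> \<delta> + \<epsilon>"
        using norm_triangle_ineq[of "q - v0 t" "v0 t - v t"] q(2) contr[OF t]
        by (simp add: norm_minus_commute)
      have "v (t + h) - Y (v t) = (v (t + h) - v0 (t + h)) + (v0 (t + h) - Y q) + (Y q - Y (v t))" by simp
      then have "norm (v (t + h) - Y (v t))
          \<le> norm (v (t + h) - v0 (t + h)) + norm (v0 (t + h) - Y q) + norm (Y q - Y (v t))"
        by (metis norm_triangle_le norm_triangle_ineq add_right_mono)
      then have "norm (v (t + h) - Y (v t)) \<le> e"
        using 1 2 3 contr[of "t + h"] t h \<delta>(3) by (simp add: \<epsilon>_def)
      then show "norm (semigroup_of C (t + h) x
          - discrete_evolution A B lam (t + h) t (semigroup_of C t x)) \<le> e"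
        using semigroup_of_eq[OF v x] t h by (simp add: discrete_evolution_def Y_def m_def n_def)
    qed
  qed
qed

lemma fb_step_in_domain: "r > 0 \<Longrightarrow> T r p \<in> op_domain A"
  by (erule fb_stepE[of r p]) (auto simp: op_domain_def)

text \<open>The starting point is arbitrary and early steps may be too large for any estimate. After
  finitely many steps the orbit enters some \<open>slow M\<close> and stays there, so
  \<open>M\<close> is fixed before \<open>\<delta>\<close> is chosen.\<close>

lemma fb_almost_orbit:
  "almost_orbit (semigroup_evolution C) (\<lambda>t. fb_compose A B lam 0 (step_index lam t) x)"
proof (rule almost_orbitI)
  fix \<epsilon> :: real assume \<epsilon>: "\<epsilon> > 0"
  obtain N where N: "small_tail lam (\<theta> / K) m" if "m \<ge> N" for m
    using small_tail_eventually[where lam = lam, OF pos sq, of "\<theta> / K"] \<theta>_pos K_pos by (auto simp: eventually_sequentially)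
  define X where "X n = fb_compose A B lam 0 n x" for n
  \<comment> \<open>The index \<open>Suc N\<close> guarantees at least one resolvent step: for
    \<open>N = 0\<close>, \<open>X N\<close> is the arbitrary point \<open>x\<close>.\<close>
  have "X (Suc N) \<in> op_domain A"
    unfolding X_def using pos by (simp add: fb_compose_Suc fb_step_in_domain)
  then obtain M where M: "X (Suc N) \<in> slow M" using domain_slow by blast
  have slow: "X n \<in> slow M" if n: "n \<ge> Suc N" for n
  proof -
    have "fb_compose A B lam (Suc N) n (X (Suc N)) \<in> slow M"
    proof (rule fb_compose_slow[OF n])
      fix i assume i: "Suc N < i"
      then show "lam i > 0" using pos by simp
      have "lam i \<le> \<theta> / K" using N[of N] i by (simp add: small_tail_def)
      then show "K * lam i \<le> \<theta>" using K_pos by (simp add: field_simps)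
    qed (rule M)
    then show ?thesis using n by (simp add: X_def fb_compose_trans)
  qed
  obtain \<delta> where \<delta>: "\<delta> > 0" "K * \<delta> \<le> \<theta>" "tail_error M \<delta> \<le> \<epsilon>"
    using tail_error_small[OF \<epsilon>] .
  have "eventually (\<lambda>n. small_tail lam \<delta> n \<and> n \<ge> Suc N) sequentially"
    by (intro eventually_conj small_tail_eventually[where lam = lam, OF pos sq \<delta>(1)] eventually_ge_at_top)
  from eventually_step_index[OF this]
  show "eventually (\<lambda>t. \<forall>h\<ge>0. norm (fb_compose A B lam 0 (step_index lam (t + h)) x
      - semigroup_evolution C (t + h) t (fb_compose A B lam 0 (step_index lam t) x)) \<le> \<epsilon>) at_top"
  proof eventually_elim
    case (elim t)
    show ?case
    proof (intro allI impI)
      fix h :: real assume h: "h \<ge> 0"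
      define m where "m = step_index lam t"
      define n where "n = step_index lam (t + h)"
      have t: "t \<ge> 0" and tail: "small_tail lam \<delta> m" and mN: "m \<ge> Suc N" using elim by (auto simp: m_def)
      have mn: "m \<le> n" unfolding m_def n_def using t h by (intro step_index_mono) auto
      have Xm: "X m \<in> slow M" using slow[OF mN] .
      then have Xc: "X m \<in> closure (op_domain A)"
        using slow_subset_domain closure_subset by blast
      obtain v where v: "integral_solution C (X m) v" using integral_solution_exists[OF Xc] by blast
      have "norm (v h - fb_compose A B lam m n (X m)) \<le> tail_error M \<delta> - \<delta>"
      proof (rule fb_compose_tail[where lam = lam, OF v integral_solution_lipschitz[OF v Xm] Xm _ pos tail \<delta>(1,2) mn h])
        show "norm (X m - X m) \<le> \<delta>" using \<delta> by simp
        show "\<bar>step_sum lam n - step_sum lam m - h\<bar> \<le> \<delta>"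
          using step_index_gap[OF tail[unfolded m_def] t h] by (simp add: m_def n_def)
      qed
      moreover have "fb_compose A B lam m n (X m) = X n"
        using mn by (simp add: X_def fb_compose_trans)
      ultimately have "norm (X n - v h) \<le> \<epsilon>" using \<delta> by (simp add: norm_minus_commute)
      then show "norm (fb_compose A B lam 0 (step_index lam (t + h)) x
          - semigroup_evolution C (t + h) t (fb_compose A B lam 0 (step_index lam t) x)) \<le> \<epsilon>"
        using semigroup_of_eq[OF v Xc h] by (simp add: semigroup_evolution_def X_def m_def n_def)
    qed
  qed
qed

end

end

theorem theorem4p3:
  fixes A :: "'a::banach \<Rightarrow> 'a set"
    and B :: "'a \<Rightarrow> 'a"
    and \<theta> :: real
    and lam :: "nat \<Rightarrow> real"
  assumes "two_uniformly_convex TYPE('a \<Rightarrow>\<^sub>L real)"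
    and "m_accretive A"
    and "\<theta> > 0"
    and "cocoercive \<theta> B"
    and "\<And>n. n \<ge> 1 \<Longrightarrow> lam n > 0"
    and "summable (\<lambda>n. (lam (Suc n))\<^sup>2)"
    and "\<not> summable (\<lambda>n. lam (Suc n))"
  shows "(\<forall>x\<in>closure (op_domain A).
            almost_orbit (discrete_evolution A B lam)
              (\<lambda>t. semigroup_of (op_sum A B) t x)) \<and>
         (\<forall>x. almost_orbit (semigroup_evolution (op_sum A B))
              (\<lambda>t. fb_compose A B lam 0 (step_index lam t) x))"
proof -
  obtain K where K: "K > 0" "\<And>(x::'a) y f g. f \<in> duality_set x \<Longrightarrow> g \<in> duality_set y \<Longrightarrow>
      norm (f - g) \<le> K * norm (x - y)"
    using duality_set_lipschitz[OF assms(1)] by metis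
  interpret forward_backward A B \<theta> K
    by unfold_locales (fact K assms)+
  show ?thesis
    using semigroup_almost_orbit[OF assms(5-7)] fb_almost_orbit[OF assms(5-7)] by blast
qed

end
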